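(* Let $p=0.05$, $q=0.4$, let $\mathcal N_1(\rho)=q\rho+(1-q)\sigma_z\rho\sigma_z$ be the qubit dephasing channel and $\mathcal N_2(\rho)=(1-p)\rho+p\,(\operatorname{Tr}\rho)\,I/2$ the qubit depolarizing channel. Let $H\in\{\sigma_x,\sigma_y,\sigma_z\}$ and $E\in(-1,1)$, and consider the AB algorithm for minimizing $f(\rho)=-D(\sqrt{\rho}\,\Gamma^{\mathcal N_1}\sqrt{\rho}\,\|\,\sqrt{\rho}\,\Gamma^{\mathcal N_2}\sqrt{\rho})=\operatorname{Tr}[\rho\,\Omega(\rho)]$ over $\mathcal M=\{\rho:\rho\text{ a qubit density operator},\ \operatorname{Tr}\rho H=E\}$. Then $\hat\rho=\frac12(I+EH)$ is the unique full-rank fixed point of the AB algorithm, i.e. the unique positive-definite $\rho\in\mathcal M$ with $\mathcal T_{AB}(\rho)=\rho$.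
   Context: $\mathcal H_A=\mathcal H_B=\mathbb C^2$; $\sigma_x,\sigma_y,\sigma_z$ are the Pauli matrices; $\log$ is the natural logarithm. For a channel $\mathcal N$ from $A$ to $B$, the (unnormalized) Choi matrix is $\Gamma^{\mathcal N}=\sum_{i,j}|i\rangle\langle j|_A\otimes\mathcal N(|i\rangle\langle j|)_B$. $D(\sigma\|\tau)=\operatorname{Tr}\,\sigma(\log\sigma-\log\tau)$. For a positive-definite state $\rho$ on $A$, powers of $\rho$ are understood as acting as $\rho^{s}\otimes I_B$, and $$\Omega_1(\rho)=-\operatorname{Tr}_B\!\big(\Gamma^{\mathcal N_1}\rho^{1/2}\big(\log(\rho^{1/2}\Gamma^{\mathcal N_1}\rho^{1/2})-\log(\rho^{1/2}\Gamma^{\mathcal N_2}\rho^{1/2})\big)\rho^{-1/2}\big),\qquad \Omega(\rho)=\tfrac12(\Omega_1(\rho)+\Omega_1(\rho)^\dagger),$$ where the logarithm of the singular operator $\rho^{1/2}\Gamma^{\mathcal N_1}\rho^{1/2}$ is taken on its support (and is $0$ on its kernel). With a fixed $\gamma>0$, the Arimoto–Blahut (AB) map is, for positive-definite $\rho\in\mathcal M$, $\mathcal T_{AB}(\rho)=\arg\min_{\sigma\in\mathcal M}D(\sigma\|\mathcal F_3[\rho])$, where $\mathcal F_3[\rho]=\exp(\log\rho-\tfrac1\gamma\Omega(\rho))/\operatorname{Tr}\exp(\log\rho-\tfrac1\gamma\Omega(\rho))$. *)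

theory Defs
  imports "HOL-Analysis.Analysis"
begin

text \<open>
  Operators on a finite-dimensional complex Hilbert space are square matrices over
  \<open>complex\<close>; an operator on the tensor product of the spaces indexed by \<open>'a\<close> and \<open>'b\<close>
  is a matrix indexed by \<open>'a \<times> 'b\<close>.
\<close>

type_synonym 'n cmat = "complex^'n^'n"

definition dagger :: "'n::finite cmat \<Rightarrow> 'n cmat" where
  "dagger A = (\<chi> i j. cnj (A $ j $ i))"

definition hermitian :: "'n::finite cmat \<Rightarrow> bool" where
  "hermitian A \<longleftrightarrow> dagger A = A"

definition unitary :: "'n::finite cmat \<Rightarrow> bool" where
  "unitary U \<longleftrightarrow> dagger U ** U = mat 1 \<and> U ** dagger U = mat 1"

definition quad_form :: "'n::finite cmat \<Rightarrow> complex^'n \<Rightarrow> complex" where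
  "quad_form A v = (\<Sum>i\<in>UNIV. cnj (v $ i) * (A *v v) $ i)"

definition pos_semidef :: "'n::finite cmat \<Rightarrow> bool" where
  "pos_semidef A \<longleftrightarrow> hermitian A \<and> (\<forall>v. 0 \<le> Re (quad_form A v))"

definition pos_def :: "'n::finite cmat \<Rightarrow> bool" where
  "pos_def A \<longleftrightarrow> hermitian A \<and> (\<forall>v. v \<noteq> 0 \<longrightarrow> 0 < Re (quad_form A v))"

definition density_operator :: "'n::finite cmat \<Rightarrow> bool" where
  "density_operator A \<longleftrightarrow> pos_semidef A \<and> trace A = 1"

definition real_diag :: "('n::finite \<Rightarrow> real) \<Rightarrow> 'n cmat" where
  "real_diag d = (\<chi> i j. if i = j then complex_of_real (d i) else 0)"

text \<open>
  Functional calculus for Hermitian matrices: \<open>f\<close> acts on the eigenvalues. The lemma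
  \<open>herm_fun_eq\<close> below shows that the result does not depend on the chosen diagonalization.
\<close>

definition herm_fun :: "(real \<Rightarrow> real) \<Rightarrow> 'n::finite cmat \<Rightarrow> 'n cmat" where
  "herm_fun f A = (THE B. \<exists>U d. unitary U \<and> A = U ** real_diag d ** dagger U \<and>
                               B = U ** real_diag (\<lambda>i. f (d i)) ** dagger U)"

lemma real_diag_mult_nth:
  "(real_diag d ** W) $ i $ j = complex_of_real (d i) * W $ i $ j"
  "(W ** real_diag d) $ i $ j = W $ i $ j * complex_of_real (d j)"
  by (simp_all add: real_diag_def matrix_matrix_mult_def if_distrib if_distribR sum.delta cong: if_cong)

lemma herm_fun_eq:
  assumes U: "unitary U"
  shows "herm_fun f (U ** real_diag d ** dagger U) = U ** real_diag (\<lambda>i. f (d i)) ** dagger U"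
  unfolding herm_fun_def
proof (rule the_equality)
  show "\<exists>V e. unitary V \<and> U ** real_diag d ** dagger U = V ** real_diag e ** dagger V \<and>
          U ** real_diag (\<lambda>i. f (d i)) ** dagger U = V ** real_diag (\<lambda>i. f (e i)) ** dagger V"
    using U by blast
next
  fix B
  assume "\<exists>V e. unitary V \<and> U ** real_diag d ** dagger U = V ** real_diag e ** dagger V \<and>
            B = V ** real_diag (\<lambda>i. f (e i)) ** dagger V"
  then obtain V e where V: "unitary V"
    and eq: "U ** real_diag d ** dagger U = V ** real_diag e ** dagger V"
    and B: "B = V ** real_diag (\<lambda>i. f (e i)) ** dagger V" by blast
  define W where "W = dagger V ** U"
  have VW: "V ** W = U" and WU: "W ** dagger U = dagger V"
    and UU: "dagger U ** U = mat 1" and VV: "dagger V ** V = mat 1"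
    using U V by (simp_all add: W_def unitary_def matrix_mul_assoc)
      (simp add: matrix_mul_assoc [symmetric])
  have "W ** real_diag d = dagger V ** (U ** real_diag d ** dagger U) ** U"
    by (simp add: matrix_mul_assoc [symmetric] UU W_def)
  also have "\<dots> = real_diag e ** W"
    unfolding eq W_def matrix_mul_assoc VV by simp
  finally have W: "W ** real_diag d = real_diag e ** W" .
  have *: "W $ i $ j * complex_of_real (f (d j)) = complex_of_real (f (e i)) * W $ i $ j" for i j
  proof (cases "W $ i $ j = 0")
    case False
    have "W $ i $ j * complex_of_real (d j) = complex_of_real (e i) * W $ i $ j"
      using arg_cong [OF W, of "\<lambda>X. X $ i $ j"] by (simp only: real_diag_mult_nth)
    with False have "d j = e i" by simp
    then show ?thesis by simp
  qed simp
  have fW: "W ** real_diag (\<lambda>i. f (d i)) = real_diag (\<lambda>i. f (e i)) ** W"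
    unfolding vec_eq_iff real_diag_mult_nth by (intro allI *)
  have "U ** real_diag (\<lambda>i. f (d i)) ** dagger U = V ** (W ** real_diag (\<lambda>i. f (d i))) ** dagger U"
    by (simp only: VW matrix_mul_assoc)
  also have "\<dots> = V ** real_diag (\<lambda>i. f (e i)) ** (W ** dagger U)"
    by (simp only: fW matrix_mul_assoc)
  also have "\<dots> = B"
    by (simp only: WU B)
  finally show "B = U ** real_diag (\<lambda>i. f (d i)) ** dagger U" ..
qed

text \<open>The logarithm of a positive semidefinite matrix is taken on its support and is 0 on its kernel.\<close>

definition mlog :: "'n::finite cmat \<Rightarrow> 'n cmat" where
  "mlog = herm_fun (\<lambda>x. if 0 < x then ln x else 0)"

definition mexp :: "'n::finite cmat \<Rightarrow> 'n cmat" where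
  "mexp = herm_fun exp"

definition mpow :: "'n::finite cmat \<Rightarrow> real \<Rightarrow> 'n cmat" where
  "mpow A s = herm_fun (\<lambda>x. x powr s) A"

text \<open>
  This trace formula is the relative entropy whenever the support of the first argument is
  contained in that of the second, which is the case at every use below (elsewhere the
  relative entropy would be infinite).
\<close>

definition rel_entropy :: "'n::finite cmat \<Rightarrow> 'n cmat \<Rightarrow> real" where
  "rel_entropy S T = Re (trace (S ** (mlog S - mlog T)))"

definition kron :: "'a::finite cmat \<Rightarrow> 'b::finite cmat \<Rightarrow> ('a \<times> 'b) cmat" where
  "kron A B = (\<chi> x y. A $ fst x $ fst y * B $ snd x $ snd y)"

definition ptrace_B :: "('a::finite \<times> 'b::finite) cmat \<Rightarrow> 'a cmat" where
  "ptrace_B X = (\<chi> i j. \<Sum>b\<in>UNIV. X $ (i, b) $ (j, b))"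

text \<open>The matrix unit \<open>|i\<rangle>\<langle>j|\<close>.\<close>

definition mat_unit :: "'n \<Rightarrow> 'n \<Rightarrow> 'n::finite cmat" where
  "mat_unit i j = (\<chi> k l. if k = i \<and> l = j then 1 else 0)"

definition choi :: "('a::finite cmat \<Rightarrow> 'b::finite cmat) \<Rightarrow> ('a \<times> 'b) cmat" where
  "choi N = (\<Sum>i\<in>UNIV. \<Sum>j\<in>UNIV. kron (mat_unit i j) (N (mat_unit i j)))"

definition pow_A :: "'a::finite cmat \<Rightarrow> real \<Rightarrow> ('a \<times> 'b::finite) cmat" where
  "pow_A \<rho> s = kron (mpow \<rho> s) (mat 1)"

definition sandwich ::
  "('a::finite cmat \<Rightarrow> 'b::finite cmat) \<Rightarrow> 'a cmat \<Rightarrow> ('a \<times> 'b) cmat" where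
  "sandwich N \<rho> = pow_A \<rho> (1/2) ** choi N ** pow_A \<rho> (1/2)"

definition objective ::
  "('a::finite cmat \<Rightarrow> 'b::finite cmat) \<Rightarrow> ('a cmat \<Rightarrow> 'b cmat) \<Rightarrow> 'a cmat \<Rightarrow> real" where
  "objective N1 N2 \<rho> = - rel_entropy (sandwich N1 \<rho>) (sandwich N2 \<rho>)"

definition Omega1 ::
  "('a::finite cmat \<Rightarrow> 'b::finite cmat) \<Rightarrow> ('a cmat \<Rightarrow> 'b cmat) \<Rightarrow> 'a cmat \<Rightarrow> 'a cmat" where
  "Omega1 N1 N2 \<rho> =
     - ptrace_B (choi N1 ** pow_A \<rho> (1/2) **
                 (mlog (sandwich N1 \<rho>) - mlog (sandwich N2 \<rho>)) ** pow_A \<rho> (-1/2))"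

definition Omega ::
  "('a::finite cmat \<Rightarrow> 'b::finite cmat) \<Rightarrow> ('a cmat \<Rightarrow> 'b cmat) \<Rightarrow> 'a cmat \<Rightarrow> 'a cmat" where
  "Omega N1 N2 \<rho> = (1/2) *\<^sub>R (Omega1 N1 N2 \<rho> + dagger (Omega1 N1 N2 \<rho>))"

text \<open>The trace in the normalization is real because the exponent is Hermitian.\<close>

definition F3 ::
  "('a::finite cmat \<Rightarrow> 'b::finite cmat) \<Rightarrow> ('a cmat \<Rightarrow> 'b cmat) \<Rightarrow> real \<Rightarrow> 'a cmat \<Rightarrow> 'a cmat" where
  "F3 N1 N2 \<gamma> \<rho> =
     (let X = mexp (mlog \<rho> - (1/\<gamma>) *\<^sub>R Omega N1 N2 \<rho>) in (1 / Re (trace X)) *\<^sub>R X)"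

definition constraint_set :: "'a::finite cmat \<Rightarrow> real \<Rightarrow> 'a cmat set" where
  "constraint_set H E = {\<rho>. density_operator \<rho> \<and> trace (\<rho> ** H) = complex_of_real E}"

text \<open>
  For \<open>\<rho>\<close> positive definite the second argument of the relative entropy is positive definite,
  so the minimizer over a nonempty (compact and convex) constraint set exists and is unique.
\<close>

definition T_AB ::
  "('a::finite cmat \<Rightarrow> 'b::finite cmat) \<Rightarrow> ('a cmat \<Rightarrow> 'b cmat) \<Rightarrow> real \<Rightarrow> 'a cmat set \<Rightarrow>
   'a cmat \<Rightarrow> 'a cmat" where
  "T_AB N1 N2 \<gamma> M \<rho> = arg_min_on (\<lambda>\<sigma>. rel_entropy \<sigma> (F3 N1 N2 \<gamma> \<rho>)) M"

definition sigma_x :: "2 cmat" where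
  "sigma_x = vector [vector [0, 1], vector [1, 0]]"

definition sigma_y :: "2 cmat" where
  "sigma_y = vector [vector [0, - \<i>], vector [\<i>, 0]]"

definition sigma_z :: "2 cmat" where
  "sigma_z = vector [vector [1, 0], vector [0, - 1]]"

definition dephasing :: "real \<Rightarrow> 2 cmat \<Rightarrow> 2 cmat" where
  "dephasing q X = q *\<^sub>R X + (1 - q) *\<^sub>R (sigma_z ** X ** sigma_z)"

text \<open>Here \<open>mat c\<close> is \<open>c\<close> times the identity.\<close>

definition depolarizing :: "real \<Rightarrow> 2 cmat \<Rightarrow> 2 cmat" where
  "depolarizing p X = (1 - p) *\<^sub>R X + p *\<^sub>R mat (trace X / 2)"

end

theory Submission
  imports Defs
begin

text \<open>
  On qubits the minimizer of \<open>D(\<cdot> \<parallel> exp G / Tr exp G)\<close> over \<open>{\<sigma>. Tr \<sigma>H = E}\<close> is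
  \<open>exp (G + \<lambda>H) / Tr exp (G + \<lambda>H)\<close> for the \<open>\<lambda>\<close> that meets the constraint, by Klein's inequality.
  Hence \<open>\<rho>\<close> is a fixed point exactly if \<open>\<Omega>(\<rho>)\<close> lies in the span of \<open>I\<close> and \<open>H\<close>.
  Explicit block diagonalizations of the two sandwiched Choi matrices show that for
  \<open>\<rho> = I/2 + a\<sigma>\<^sub>x + b\<sigma>\<^sub>y + c\<sigma>\<^sub>z\<close> one has
  \<open>\<Omega>(\<rho>) = \<alpha>I + k(a\<sigma>\<^sub>x + b\<sigma>\<^sub>y) + lc\<sigma>\<^sub>z\<close> with \<open>k, l > 0\<close>; the sign of \<open>l\<close> is where the
  values of \<open>p\<close> and \<open>q\<close> and the monotonicity of \<open>artanh x / x\<close> enter. So \<open>\<Omega>(\<rho>)\<close> is in the span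
  of \<open>I\<close> and a Pauli matrix \<open>H\<close> only if the Bloch vector of \<open>\<rho>\<close> is parallel to that of \<open>H\<close>.
\<close>

text \<open>The two Choi matrices are adapted to different bases, and no single change of basis
  serves both. The dephasing one is supported on the span of |11> and |22> in the fixed sigma_z
  basis. The vectors \<open>\<rho>\<^sup>1\<^sup>/\<^sup>2\<close>|s>|s> stay orthogonal because
  <ss|(\<rho> \<otimes> I)|tt> vanishes for s \<noteq> t, so its logarithm sees only the diagonal of
  \<rho> and contributes to Omega only along I and sigma_z. The depolarizing one is invariant under
  U \<otimes> conj U, so inside its logarithm \<rho> may be taken diagonal; but the result is then
  multiplied by the dephasing Choi matrix, which lacks this invariance, so the logarithm must be
  expanded in terms whose rotated forms are known. In Omega the first logarithm enters with a minus
  sign and the second with a plus sign. Hence \<open>k\<close> is a sum of positive terms, and only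
  \<open>l\<close> is a genuine difference. For a Pauli matrix H the map (a, b, c) to (ka, kb, lc)
  preserves the axis of H, which gives the fixed point; \<open>k\<close>, \<open>l\<close> > 0
  excludes every other direction.\<close>

section \<open>Qubit operators in Pauli coordinates\<close>

text \<open>\<open>bloch t x y z = tI + x\<sigma>\<^sub>x + y\<sigma>\<^sub>y + z\<sigma>\<^sub>z\<close>; a state has \<open>t = 1/2\<close>, so its vector has length at most 1/2.\<close>

definition bloch :: "real \<Rightarrow> real \<Rightarrow> real \<Rightarrow> real \<Rightarrow> 2 cmat" where
  "bloch t x y z = vector [vector [complex_of_real (t + z), Complex x (-y)],
                        vector [Complex x y, complex_of_real (t - z)]]"

lemma bloch_nth [simp]:
  "bloch t x y z $ 1 $ 1 = complex_of_real (t + z)" "bloch t x y z $ 1 $ 2 = Complex x (-y)"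
  "bloch t x y z $ 2 $ 1 = Complex x y" "bloch t x y z $ 2 $ 2 = complex_of_real (t - z)"
  by (simp_all add: bloch_def)

lemma mat2_eq_iff:
  "(A :: 2 cmat) = B \<longleftrightarrow> A$1$1 = B$1$1 \<and> A$1$2 = B$1$2 \<and> A$2$1 = B$2$1 \<and> A$2$2 = B$2$2"
  by (auto simp: vec_eq_iff forall_2)

lemma bloch_eq_iff [simp]: "bloch t x y z = bloch t' x' y' z' \<longleftrightarrow> t = t' \<and> x = x' \<and> y = y' \<and> z = z'"
  by (auto simp: mat2_eq_iff complex_eq_iff)

lemma sigma_bloch: "sigma_x = bloch 0 1 0 0" "sigma_y = bloch 0 0 1 0" "sigma_z = bloch 0 0 0 1"
  by (simp_all add: mat2_eq_iff sigma_x_def sigma_y_def sigma_z_def complex_eq_iff)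

lemma mat_1_bloch: "mat 1 = bloch 1 0 0 0"
  by (simp add: mat2_eq_iff mat_def complex_eq_iff)

lemma bloch_add: "bloch t x y z + bloch t' x' y' z' = bloch (t + t') (x + x') (y + y') (z + z')"
  by (simp add: mat2_eq_iff complex_eq_iff)

lemma bloch_diff: "bloch t x y z - bloch t' x' y' z' = bloch (t - t') (x - x') (y - y') (z - z')"
  by (simp add: mat2_eq_iff complex_eq_iff)

lemma bloch_scaleR: "a *\<^sub>R bloch t x y z = bloch (a * t) (a * x) (a * y) (a * z)"
  by (simp add: mat2_eq_iff complex_eq_iff algebra_simps)

lemma mult_nth_2: "((A :: 2 cmat) ** B) $ i $ j = A $ i $ 1 * B $ 1 $ j + A $ i $ 2 * B $ 2 $ j"
  by (simp add: matrix_matrix_mult_def sum_2)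

lemma trace_2: "trace (A :: 2 cmat) = A $ 1 $ 1 + A $ 2 $ 2"
  by (simp add: trace_def sum_2)

lemma trace_bloch: "trace (bloch t x y z) = complex_of_real (2 * t)"
  by (simp add: trace_2)

lemma trace_bloch_mult:
  "trace (bloch t x y z ** bloch t' x' y' z') = complex_of_real (2 * (t * t' + x * x' + y * y' + z * z'))"
  by (simp add: trace_2 mult_nth_2 complex_eq_iff algebra_simps)

lemma dagger_nth [simp]: "dagger A $ i $ j = cnj (A $ j $ i)"
  by (simp add: dagger_def)

lemma hermitian_bloch: "hermitian (bloch t x y z)"
  by (simp add: hermitian_def mat2_eq_iff complex_eq_iff)

lemma hermitian_2_obtain:
  fixes A :: "2 cmat"
  assumes "hermitian A"
  obtains t x y z where "A = bloch t x y z"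
proof -
  have *: "cnj (A $ j $ i) = A $ i $ j" for i j
    using assms by (metis dagger_nth hermitian_def)
  have "A = bloch ((Re (A$1$1) + Re (A$2$2)) / 2) (Re (A$2$1)) (Im (A$2$1)) ((Re (A$1$1) - Re (A$2$2)) / 2)"
    using *[of 1 1] *[of 2 2] *[of 1 2]
    by (auto simp: mat2_eq_iff complex_eq_iff field_simps)
  then show ?thesis using that by blast
qed

section \<open>Positivity of Hermitian 2x2 matrices in Pauli coordinates\<close>

lemma Re_quad_form_bloch:
  "Re (quad_form (bloch t x y z) v) =
     (t + z) * ((Re (v$1))\<^sup>2 + (Im (v$1))\<^sup>2) + (t - z) * ((Re (v$2))\<^sup>2 + (Im (v$2))\<^sup>2) + 2 * Re (cnj (v$1) * Complex x (-y) * v$2)"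
  by (simp add: quad_form_def sum_2 matrix_vector_mult_def) (simp add: algebra_simps power2_eq_square)

text \<open>Polar form in which the zero vector receives an arbitrary direction, so multiples of the
  identity need no separate case in the spectral formulas.\<close>

lemma exists_unit_vector:
  fixes x y z :: real
  obtains r a b c where "0 \<le> r" "a\<^sup>2 + b\<^sup>2 + c\<^sup>2 = 1" "x = r * a" "y = r * b" "z = r * c"
    "r\<^sup>2 = x\<^sup>2 + y\<^sup>2 + z\<^sup>2"
proof (cases "x\<^sup>2 + y\<^sup>2 + z\<^sup>2 = 0")
  case True
  then have "x = 0" "y = 0" "z = 0" by (auto simp: add_nonneg_eq_0_iff)
  then show ?thesis using that[of 0 1 0 0] by simp
next
  case False
  let ?r = "sqrt (x\<^sup>2 + y\<^sup>2 + z\<^sup>2)"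
  have "x\<^sup>2 + y\<^sup>2 + z\<^sup>2 > 0" using False by (smt (verit) zero_le_power2)
  then have "?r > 0" "?r\<^sup>2 = x\<^sup>2 + y\<^sup>2 + z\<^sup>2" by auto
  then show ?thesis using that[of ?r "x / ?r" "y / ?r" "z / ?r"] False
    by (auto simp: power_divide add_divide_distrib [symmetric] simp del: real_sqrt_pow2_iff real_sqrt_pow2)
qed

text \<open>The test vectors are the columns of the adjugate: on them the form equals a diagonal
  entry times the determinant t^2 - (x^2 + y^2 + z^2). Since \<open>0 < t\<close>, at least one
  diagonal entry is positive.\<close>

lemma pos_semidef_bloch:
  assumes "pos_semidef (bloch t x y z)" "0 < t"
  shows "x\<^sup>2 + y\<^sup>2 + z\<^sup>2 \<le> t\<^sup>2"
proof -
  have q: "0 \<le> Re (quad_form (bloch t x y z) v)" for v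
    using assms by (simp add: pos_semidef_def)
  show ?thesis
  proof (cases "t + z > 0")
    case True
    have "0 \<le> (t + z) * (t\<^sup>2 - (x\<^sup>2 + y\<^sup>2 + z\<^sup>2))"
      using q[of "vector [- Complex x (-y), complex_of_real (t + z)]"]
      by (simp add: Re_quad_form_bloch power2_eq_square algebra_simps)
    then show ?thesis using True by (simp add: zero_le_mult_iff)
  next
    case False
    then have tz: "t - z > 0" using assms by linarith
    have "0 \<le> (t - z) * (t\<^sup>2 - (x\<^sup>2 + y\<^sup>2 + z\<^sup>2))"
      using q[of "vector [complex_of_real (t - z), - Complex x y]"]
      by (simp add: Re_quad_form_bloch power2_eq_square algebra_simps)
    then show ?thesis using tz by (simp add: zero_le_mult_iff)
  qed
qed

lemma quad_form_zero: "quad_form A 0 = 0"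
  by (simp add: quad_form_def)

lemma pos_def_imp_pos_semidef: "pos_def A \<Longrightarrow> pos_semidef A"
  unfolding pos_def_def pos_semidef_def
  by (metis less_eq_real_def quad_form_zero zero_complex.sel(1))

lemma pos_def_blochD:
  assumes "pos_def (bloch t x y z)" "0 < t"
  shows "x\<^sup>2 + y\<^sup>2 + z\<^sup>2 < t\<^sup>2"
proof -
  have q: "v \<noteq> 0 \<Longrightarrow> 0 < Re (quad_form (bloch t x y z) v)" for v
    using assms by (simp add: pos_def_def)
  show ?thesis
  proof (cases "t + z > 0")
    case True
    then have "vector [- Complex x (-y), complex_of_real (t + z)] \<noteq> (0::complex^2)"
      by (simp add: vec_eq_iff forall_2 complex_eq_iff)
    from q[OF this] have "0 < (t + z) * (t\<^sup>2 - (x\<^sup>2 + y\<^sup>2 + z\<^sup>2))"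
      by (simp add: Re_quad_form_bloch power2_eq_square algebra_simps)
    then show ?thesis using True by (simp add: zero_less_mult_iff)
  next
    case False
    then have tz: "t - z > 0" using assms by linarith
    then have "vector [complex_of_real (t - z), - Complex x y] \<noteq> (0::complex^2)"
      by (simp add: vec_eq_iff forall_2 complex_eq_iff)
    from q[OF this] have "0 < (t - z) * (t\<^sup>2 - (x\<^sup>2 + y\<^sup>2 + z\<^sup>2))"
      by (simp add: Re_quad_form_bloch power2_eq_square algebra_simps)
    then show ?thesis using tz by (simp add: zero_less_mult_iff)
  qed
qed

lemma pos_def_blochI:
  assumes "0 < t" "x\<^sup>2 + y\<^sup>2 + z\<^sup>2 < t\<^sup>2"
  shows "pos_def (bloch t x y z)"
  unfolding pos_def_def
proof (intro conjI hermitian_bloch allI impI)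
  fix v :: "complex^2" assume v: "v \<noteq> 0"
  have "z\<^sup>2 < t\<^sup>2" using assms by (smt (verit) zero_le_power2)
  then have tz: "t + z > 0" using assms(1) power2_less_imp_less[of "-z" t] by simp
  \<comment> \<open>Completing the square in the first coordinate; the remainder is the determinant
    times |v2|^2.\<close>
  have "(t + z) * Re (quad_form (bloch t x y z) v) =
      (cmod ((t + z) * v$1 + Complex x (-y) * v$2))\<^sup>2 + (t\<^sup>2 - (x\<^sup>2 + y\<^sup>2 + z\<^sup>2)) * (cmod (v$2))\<^sup>2"
    unfolding Re_quad_form_bloch cmod_power2 by (simp add: power2_eq_square algebra_simps)
  also have "\<dots> > 0"
  proof (cases "v $ 2 = 0")
    case True
    then have "v $ 1 \<noteq> 0" using v by (auto simp: vec_eq_iff forall_2)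
    then have "complex_of_real (t + z) * v $ 1 \<noteq> 0" using tz
      by (metis mult_eq_0_iff of_real_eq_0_iff order_less_irrefl)
    then show ?thesis using True by simp
  next
    case False
    then show ?thesis using assms by (intro add_nonneg_pos mult_pos_pos) auto
  qed
  finally show "0 < Re (quad_form (bloch t x y z) v)" using tz by (simp add: zero_less_mult_iff)
qed

text \<open>One unitary serves all \<open>d\<close> at once, since it depends only on the direction
  of the Bloch vector. This is what lets \<open>herm_fun_bloch\<close> keep that direction for every
  function \<open>f\<close>.\<close>

lemma qubit_spectral:
  fixes x y z :: real
  assumes "x\<^sup>2 + y\<^sup>2 + z\<^sup>2 = 1"
  obtains U :: "2 cmat" where "unitary U"
    "\<And>d. U ** real_diag d ** dagger U =
       bloch ((d 1 + d 2) / 2) ((d 1 - d 2) / 2 * x) ((d 1 - d 2) / 2 * y) ((d 1 - d 2) / 2 * z)"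
proof -
  \<comment> \<open>Half-angle parameters: (a, b1 + i b2) is the eigenvector with spin along (x, y,
    z), its phase chosen so that \<open>a\<close> is real. The south pole z = -1 has a = 0 and must
    be treated apart from the quotients by 2a.\<close>
  obtain a b1 b2 :: real where ab: "a\<^sup>2 + b1\<^sup>2 + b2\<^sup>2 = 1" "x = 2 * a * b1" "y = 2 * a * b2"
    "z = a\<^sup>2 - (b1\<^sup>2 + b2\<^sup>2)"
  proof (cases "z = -1")
    case True
    then have "x\<^sup>2 + y\<^sup>2 = 0" using assms by simp
    then show ?thesis using that[of 0 1 0] True by simp
  next
    case False
    have "z\<^sup>2 \<le> 1" using assms by (smt (verit) zero_le_power2)
    then have z: "1 + z > 0" using False power2_le_imp_le[of "-z" 1] by simp
    define a where "a = sqrt ((1 + z) / 2)"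
    have a: "a > 0" "a\<^sup>2 = (1 + z) / 2" using z by (simp_all add: a_def)
    have "(x / (2 * a))\<^sup>2 + (y / (2 * a))\<^sup>2 = (x\<^sup>2 + y\<^sup>2) / (4 * a\<^sup>2)"
      by (simp add: power_divide power_mult_distrib add_divide_distrib)
    also have "\<dots> = (1 - z) * (1 + z) / (2 * (1 + z))"
    proof -
      have "x\<^sup>2 + y\<^sup>2 = (1 - z) * (1 + z)" "4 * a\<^sup>2 = 2 * (1 + z)"
        using assms a(2) by (simp_all add: power2_eq_square algebra_simps)
      then show ?thesis by simp
    qed
    also have "\<dots> = (1 - z) / 2" using z by (simp add: divide_simps)
    finally have b: "(x / (2 * a))\<^sup>2 + (y / (2 * a))\<^sup>2 = (1 - z) / 2" .
    show ?thesis
      using that[of a "x / (2 * a)" "y / (2 * a)"] a unfolding add.assoc b by (simp add: divide_simps)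
  qed
  define U :: "2 cmat" where "U = vector [vector [complex_of_real a, - Complex b1 (-b2)],
     vector [Complex b1 b2, complex_of_real a]]"
  have U: "U $ 1 $ 1 = complex_of_real a" "U $ 1 $ 2 = - Complex b1 (-b2)"
    "U $ 2 $ 1 = Complex b1 b2" "U $ 2 $ 2 = complex_of_real a"
    by (simp_all add: U_def)
  show ?thesis
  proof
    show "unitary U" using ab
      by (simp add: unitary_def mat2_eq_iff mult_nth_2 U mat_def complex_eq_iff power2_eq_square algebra_simps)
    have aa: "a * a = 1 - b1 * b1 - b2 * b2"
      using ab(1) by (simp add: power2_eq_square)
    have aa': "a * (a * w) = (1 - b1 * b1 - b2 * b2) * w" for w
      by (simp only: mult.assoc [symmetric] aa)
    show "U ** real_diag d ** dagger U =
       bloch ((d 1 + d 2) / 2) ((d 1 - d 2) / 2 * x) ((d 1 - d 2) / 2 * y) ((d 1 - d 2) / 2 * z)" for d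
      by (simp add: mat2_eq_iff mult_nth_2 U real_diag_def complex_eq_iff ab(2-4))
        (simp add: aa aa' power2_eq_square field_simps)
  qed
qed

lemma herm_fun_bloch:
  assumes "x\<^sup>2 + y\<^sup>2 + z\<^sup>2 = 1"
  shows "herm_fun f (bloch t (r * x) (r * y) (r * z)) =
    (let d = (f (t + r) - f (t - r)) / 2 in bloch ((f (t + r) + f (t - r)) / 2) (d * x) (d * y) (d * z))"
proof -
  obtain U :: "2 cmat" where U: "unitary U" and
    s: "\<And>d. U ** real_diag d ** dagger U =
       bloch ((d 1 + d 2) / 2) ((d 1 - d 2) / 2 * x) ((d 1 - d 2) / 2 * y) ((d 1 - d 2) / 2 * z)"
    using qubit_spectral[OF assms] by metis
  have *: "bloch t (r * x) (r * y) (r * z) = U ** real_diag (\<lambda>i. if i = 1 then t + r else t - r) ** dagger U"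
    unfolding s by simp
  show ?thesis unfolding * herm_fun_eq[OF U] by (simp add: s Let_def)
qed

section \<open>Gibbs states and the constrained minimizer\<close>

abbreviation ln0 :: "real \<Rightarrow> real" where
  "ln0 x \<equiv> if 0 < x then ln x else 0"

lemma mlog_bloch:
  assumes "x\<^sup>2 + y\<^sup>2 + z\<^sup>2 = 1"
  shows "mlog (bloch t (r * x) (r * y) (r * z)) =
    (let d = (ln0 (t + r) - ln0 (t - r)) / 2 in bloch ((ln0 (t + r) + ln0 (t - r)) / 2) (d * x) (d * y) (d * z))"
  unfolding mlog_def herm_fun_bloch[OF assms] ..

text \<open>The scalar form of Klein's inequality, from ln u \<le> u - 1 at u = c / a. The case a =
  0 is included because the first state of a relative entropy may be singular.\<close>

lemma entropy_term_ge:
  fixes a c :: real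
  assumes "0 \<le> a" "0 < c"
  shows "a - c \<le> a * (ln0 a - ln c)" "a * (ln0 a - ln c) = a - c \<Longrightarrow> a = c"
proof -
  show "a - c \<le> a * (ln0 a - ln c)"
  proof (cases "a = 0")
    case False
    then have a: "a > 0" using assms by simp
    have "ln (c / a) \<le> c / a - 1" using a assms by (intro ln_le_minus_one) simp
    then have "a * ln (c / a) \<le> a * (c / a - 1)" using a by (intro mult_left_mono) auto
    then show ?thesis using a assms by (simp add: ln_div algebra_simps)
  qed (use assms in auto)
  show "a = c" if "a * (ln0 a - ln c) = a - c"
  proof (cases "a = 0")
    case False
    then have a: "a > 0" using assms by simp
    then have "ln (c / a) = c / a - 1" using that assms by (simp add: ln_div field_simps)
    then have "c / a = 1" using a assms by (intro ln_eq_minus_one) auto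
    then show ?thesis using a by simp
  qed (use that assms in auto)
qed

text \<open>The relative entropy splits into the classical one of the two spectra and a penalty for
  the angle between the Bloch vectors.\<close>

lemma rel_entropy_bloch:
  assumes n: "n1\<^sup>2 + n2\<^sup>2 + n3\<^sup>2 = 1" and m: "m1\<^sup>2 + m2\<^sup>2 + m3\<^sup>2 = 1"
    and s: "0 \<le> s" "s \<le> 1/2" and t: "0 \<le> t" "t < 1/2"
  shows "rel_entropy (bloch (1/2) (s * n1) (s * n2) (s * n3)) (bloch (1/2) (t * m1) (t * m2) (t * m3)) =
    (1/2 + s) * (ln0 (1/2 + s) - ln (1/2 + t)) + (1/2 - s) * (ln0 (1/2 - s) - ln (1/2 - t)) +
    s * (1 - (n1 * m1 + n2 * m2 + n3 * m3)) * (ln (1/2 + t) - ln (1/2 - t))"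
proof -
  have t': "1/2 + t > 0" "1/2 - t > 0" using t by auto
  define a b c d where "a = ln0 (1/2 + s)" "b = ln0 (1/2 - s)" "c = ln (1/2 + t)" "d = ln (1/2 - t)"
  \<comment> \<open>The unit-length relation oriented as rewrite rules; the second form catches the
    square inside a right-nested product.\<close>
  have e: "n1 * n1 = 1 - n2 * n2 - n3 * n3" "n1 * (n1 * w) = (1 - n2 * n2 - n3 * n3) * w" for w
  proof -
    show "n1 * n1 = 1 - n2 * n2 - n3 * n3" using n by (simp add: power2_eq_square)
    then show "n1 * (n1 * w) = (1 - n2 * n2 - n3 * n3) * w" by (metis mult.assoc)
  qed
  have "rel_entropy (bloch (1/2) (s * n1) (s * n2) (s * n3)) (bloch (1/2) (t * m1) (t * m2) (t * m3)) =
     2 * (1/2 * ((a + b)/2 - (c + d)/2) + s * n1 * ((a-b)/2 * n1 - (c-d)/2 * m1)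
     + s * n2 * ((a-b)/2 * n2 - (c-d)/2 * m2) + s * n3 * ((a-b)/2 * n3 - (c-d)/2 * m3))"
    unfolding rel_entropy_def mlog_bloch[OF n] mlog_bloch[OF m] Let_def bloch_diff trace_bloch_mult a_b_c_d_def
    using t' by simp
  also have "\<dots> = (1/2 + s) * (a - c) + (1/2 - s) * (b - d) + s * (1 - (n1 * m1 + n2 * m2 + n3 * m3)) * (c - d)"
    by (simp add: e field_simps)
  finally show ?thesis unfolding a_b_c_d_def .
qed

lemma trace_eq_1_bloch: "trace (bloch t x y z) = 1 \<longleftrightarrow> t = 1/2"
  unfolding trace_bloch using of_real_eq_iff[of "2 * t" 1, where ?'a = complex] by auto

lemma density_operator_bloch_obtain:
  assumes "density_operator \<sigma>"
  obtains s n1 n2 n3 where "\<sigma> = bloch (1/2) (s * n1) (s * n2) (s * n3)"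
    "n1\<^sup>2 + n2\<^sup>2 + n3\<^sup>2 = 1" "0 \<le> s" "s \<le> 1/2" "pos_def \<sigma> \<Longrightarrow> s < 1/2"
proof -
  have "hermitian \<sigma>" using assms by (simp add: density_operator_def pos_semidef_def)
  then obtain t x y z where 1: "\<sigma> = bloch t x y z" by (rule hermitian_2_obtain)
  then have t: "t = 1/2" using assms trace_eq_1_bloch by (auto simp: density_operator_def)
  obtain r a b c where r: "0 \<le> r" "a\<^sup>2 + b\<^sup>2 + c\<^sup>2 = 1" "x = r * a" "y = r * b" "z = r * c"
    "r\<^sup>2 = x\<^sup>2 + y\<^sup>2 + z\<^sup>2"
    by (rule exists_unit_vector)
  have "r\<^sup>2 \<le> (1/2)\<^sup>2" using pos_semidef_bloch[of t x y z] assms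
    by (simp add: r(6) 1 t density_operator_def)
  then have "r \<le> 1/2" using power2_le_imp_le[of r "1/2"] by simp
  moreover have "r < 1/2" if "pos_def \<sigma>"
  proof -
    have "r\<^sup>2 < (1/2)\<^sup>2" using pos_def_blochD[of t x y z] that by (simp add: r(6) 1 t)
    then show ?thesis using power2_less_imp_less[of r "1/2"] by simp
  qed
  ultimately show ?thesis using that[of r a b c] r 1 t by simp
qed

lemma unit_inner_le_1:
  fixes n1 :: real
  assumes n: "n1\<^sup>2 + n2\<^sup>2 + n3\<^sup>2 = 1" and m: "m1\<^sup>2 + m2\<^sup>2 + m3\<^sup>2 = 1"
  shows "n1 * m1 + n2 * m2 + n3 * m3 \<le> 1"
    "n1 * m1 + n2 * m2 + n3 * m3 = 1 \<Longrightarrow> n1 = m1 \<and> n2 = m2 \<and> n3 = m3"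
proof -
  have *: "(n1 - m1)\<^sup>2 + (n2 - m2)\<^sup>2 + (n3 - m3)\<^sup>2 = 2 - 2 * (n1 * m1 + n2 * m2 + n3 * m3)"
    using n m by (simp add: power2_eq_square algebra_simps)
  show "n1 * m1 + n2 * m2 + n3 * m3 \<le> 1" using * by (smt (verit) zero_le_power2)
  show "n1 = m1 \<and> n2 = m2 \<and> n3 = m3" if "n1 * m1 + n2 * m2 + n3 * m3 = 1"
    using * that by (auto simp: add_nonneg_eq_0_iff)
qed

text \<open>The lower bounds s - t and t - s for the two eigenvalue terms cancel, and the angle term
  is nonnegative. Equality forces s = t, then equal directions unless s = 0, where directions do not
  matter.\<close>

lemma klein_qubit:
  fixes \<sigma> \<tau> :: "2 cmat"
  assumes \<sigma>: "density_operator \<sigma>" and \<tau>: "density_operator \<tau>" "pos_def \<tau>"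
  shows "0 \<le> rel_entropy \<sigma> \<tau>" "rel_entropy \<sigma> \<tau> = 0 \<longleftrightarrow> \<sigma> = \<tau>"
proof -
  obtain s n1 n2 n3 where 1: "\<sigma> = bloch (1/2) (s * n1) (s * n2) (s * n3)"
    "n1\<^sup>2 + n2\<^sup>2 + n3\<^sup>2 = 1" "0 \<le> s" "s \<le> 1/2" using density_operator_bloch_obtain[OF \<sigma>] by metis
  obtain t m1 m2 m3 where 2: "\<tau> = bloch (1/2) (t * m1) (t * m2) (t * m3)"
    "m1\<^sup>2 + m2\<^sup>2 + m3\<^sup>2 = 1" "0 \<le> t" "t < 1/2" using density_operator_bloch_obtain[OF \<tau>(1)] \<tau>(2) by metis
  define A B C where "A = (1/2 + s) * (ln0 (1/2 + s) - ln (1/2 + t))"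
    "B = (1/2 - s) * (ln0 (1/2 - s) - ln (1/2 - t))"
    "C = s * (1 - (n1 * m1 + n2 * m2 + n3 * m3)) * (ln (1/2 + t) - ln (1/2 - t))"
  have eq: "rel_entropy \<sigma> \<tau> = A + B + C"
    unfolding 1(1) 2(1) A_B_C_def using 1 2 by (intro rel_entropy_bloch) auto
  have A: "s - t \<le> A" "A = s - t \<Longrightarrow> s = t"
    using entropy_term_ge[of "1/2 + s" "1/2 + t"] 1 2 by (auto simp: A_B_C_def)
  have B: "t - s \<le> B"
    using entropy_term_ge(1)[of "1/2 - s" "1/2 - t"] 1 2 unfolding A_B_C_def by auto
  have C: "0 \<le> C" unfolding A_B_C_def using 1 2 unit_inner_le_1(1)[OF 1(2) 2(2)]
    by (intro mult_nonneg_nonneg) auto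
  show "0 \<le> rel_entropy \<sigma> \<tau>" using A B C eq by linarith
  have "\<sigma> = \<tau>" if "rel_entropy \<sigma> \<tau> = 0"
  proof -
    have z: "A = s - t" "C = 0" using that A(1) B C eq by linarith+
    then have st: "s = t" using A(2) by simp
    show ?thesis
    proof (cases "s = 0")
      case False
      then have "ln (1/2 + t) \<noteq> ln (1/2 - t)" using st 1 2 by (subst ln_inj_iff) auto
      then have "n1 * m1 + n2 * m2 + n3 * m3 = 1" using z False by (auto simp: A_B_C_def)
      then show ?thesis using unit_inner_le_1(2)[OF 1(2) 2(2)] by (simp add: 1(1) 2(1) st)
    qed (use st in \<open>simp add: 1(1) 2(1)\<close>)
  qed
  moreover have "rel_entropy \<tau> \<tau> = 0" by (simp add: rel_entropy_def trace_def)
  ultimately show "rel_entropy \<sigma> \<tau> = 0 \<longleftrightarrow> \<sigma> = \<tau>" by blast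
qed

section \<open>Gibbs states and their logarithms\<close>

definition gibbs :: "'n::finite cmat \<Rightarrow> 'n cmat" where
  "gibbs G = (1 / Re (trace (mexp G))) *\<^sub>R mexp G"

lemma F3_eq_gibbs: "F3 N1 N2 \<gamma> \<rho> = gibbs (mlog \<rho> - (1/\<gamma>) *\<^sub>R Omega N1 N2 \<rho>)"
  by (simp add: F3_def gibbs_def Let_def)

text \<open>The eigenvalues of the exponential are exp (t + r) and exp (t - r); normalization
  cancels exp t and leaves sinh over cosh. Adding a multiple of the identity therefore does not
  change a Gibbs state.\<close>

lemma gibbs_bloch:
  assumes "x\<^sup>2 + y\<^sup>2 + z\<^sup>2 = 1"
  shows "gibbs (bloch t (r * x) (r * y) (r * z)) = bloch (1/2) (tanh r / 2 * x) (tanh r / 2 * y) (tanh r / 2 * z)"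
proof -
  have c: "cosh r > 0" by simp
  have e: "(exp (t + r) + exp (t - r)) / 2 = exp t * cosh r" "(exp (t + r) - exp (t - r)) / 2 = exp t * sinh r"
    by (simp_all add: cosh_def sinh_def exp_add exp_diff exp_minus algebra_simps divide_simps)
  have "mexp (bloch t (r * x) (r * y) (r * z)) =
     bloch (exp t * cosh r) (exp t * sinh r * x) (exp t * sinh r * y) (exp t * sinh r * z)"
    unfolding mexp_def herm_fun_bloch[OF assms] Let_def e ..
  then show ?thesis using c
    by (simp add: gibbs_def trace_bloch bloch_scaleR tanh_def)
qed

lemma ln_half_tanh: "ln (1/2 + tanh r / 2) = r - ln (2 * cosh r)" for r :: real
proof -
  have c: "cosh r > 0" by simp
  have "1/2 + tanh r / 2 = (cosh r + sinh r) / (2 * cosh r)"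
    using c by (simp add: tanh_def field_simps)
  also have "cosh r + sinh r = exp r" by (rule cosh_plus_sinh)
  finally show ?thesis using c by (simp add: ln_div)
qed

text \<open>The constant \<open>c\<close> is the logarithm of the partition function Tr exp G = 2
  exp t cosh r.\<close>

lemma gibbs_2:
  assumes "hermitian (G :: 2 cmat)"
  shows "pos_def (gibbs G)" "density_operator (gibbs G)" "\<exists>c. mlog (gibbs G) = G - bloch c 0 0 0"
proof -
  obtain t x y z where G: "G = bloch t x y z" using assms by (rule hermitian_2_obtain)
  obtain r a b c where r: "0 \<le> r" "a\<^sup>2 + b\<^sup>2 + c\<^sup>2 = 1" "x = r * a" "y = r * b" "z = r * c"
    by (rule exists_unit_vector)
  have gG: "gibbs G = bloch (1/2) (tanh r / 2 * a) (tanh r / 2 * b) (tanh r / 2 * c)"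
    unfolding G r(3-5) by (rule gibbs_bloch[OF r(2)])
  have th: "\<bar>tanh r\<bar> < 1" using tanh_real_bounds[of r] by auto
  have "(tanh r / 2 * a)\<^sup>2 + (tanh r / 2 * b)\<^sup>2 + (tanh r / 2 * c)\<^sup>2 = (tanh r / 2)\<^sup>2 * (a\<^sup>2 + b\<^sup>2 + c\<^sup>2)"
    unfolding power_mult_distrib by (simp add: algebra_simps)
  also have "\<dots> < (1/2)\<^sup>2" using th r(2) by (simp add: power_divide abs_square_less_1)
  finally show pd: "pos_def (gibbs G)" unfolding gG by (intro pos_def_blochI) auto
  then show "density_operator (gibbs G)"
    using pos_def_imp_pos_semidef unfolding density_operator_def gG trace_eq_1_bloch by auto
  have p: "1/2 + tanh r / 2 > 0" "1/2 - tanh r / 2 > 0" using th by auto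
  have l: "ln (1/2 - tanh r / 2) = - r - ln (2 * cosh r)" using ln_half_tanh[of "-r"] by simp
  have "mlog (gibbs G) = bloch (- ln (2 * cosh r)) (r * a) (r * b) (r * c)"
    unfolding gG mlog_bloch[OF r(2)] Let_def using p by (simp add: ln_half_tanh l)
  also have "\<dots> = G - bloch (t + ln (2 * cosh r)) 0 0 0" unfolding G r(3-5) bloch_diff by simp
  finally show "\<exists>c. mlog (gibbs G) = G - bloch c 0 0 0" by blast
qed

lemma tanh_real_surj:
  fixes y :: real
  assumes "-1 < y" "y < 1"
  obtains x where "tanh x = y"
proof -
  define x where "x = ln ((1 + y) / (1 - y)) / 2"
  have "exp (- 2 * x) = (1 - y) / (1 + y)"
    unfolding x_def using assms by (simp add: exp_minus)
  moreover have "(1 - w) / (1 + w) = y" if "w = (1 - y) / (1 + y)" for w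
    using assms unfolding that by (simp add: field_simps)
  ultimately have "tanh x = y" unfolding tanh_real_altdef by blast
  then show ?thesis using that by blast
qed

lemma gibbs_mlog:
  fixes \<rho> :: "2 cmat"
  assumes "density_operator \<rho>" "pos_def \<rho>"
  shows "hermitian (mlog \<rho>)" "gibbs (mlog \<rho> + bloch c 0 0 0) = \<rho>"
proof -
  obtain s n1 n2 n3 where 1: "\<rho> = bloch (1/2) (s * n1) (s * n2) (s * n3)"
    "n1\<^sup>2 + n2\<^sup>2 + n3\<^sup>2 = 1" "0 \<le> s" "s < 1/2" using density_operator_bloch_obtain[OF assms(1)] assms(2) by metis
  obtain r where "tanh r = 2 * s" using tanh_real_surj[of "2 * s"] 1 by auto
  then have s: "s = tanh r / 2" by simp
  have p: "1/2 + tanh r / 2 > 0" "1/2 - tanh r / 2 > 0"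
    using tanh_real_gt_neg1[of r] tanh_real_lt_1[of r] by linarith+
  have l: "ln (1/2 - tanh r / 2) = - r - ln (2 * cosh r)" using ln_half_tanh[of "-r"] by simp
  have eq: "mlog \<rho> = bloch (- ln (2 * cosh r)) (r * n1) (r * n2) (r * n3)"
    unfolding 1(1) mlog_bloch[OF 1(2)] s Let_def using p by (simp add: ln_half_tanh l)
  show "hermitian (mlog \<rho>)" unfolding eq by (rule hermitian_bloch)
  show "gibbs (mlog \<rho> + bloch c 0 0 0) = \<rho>"
    unfolding eq bloch_add using gibbs_bloch[OF 1(2), of _ r] by (simp add: 1(1) s)
qed

lemma hermitian_mlog_2: "hermitian (\<sigma> :: 2 cmat) \<Longrightarrow> hermitian (mlog \<sigma>)"
proof (elim hermitian_2_obtain)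
  fix t x y z assume *: "\<sigma> = bloch t x y z"
  obtain r a b c where r: "0 \<le> r" "a\<^sup>2 + b\<^sup>2 + c\<^sup>2 = 1" "x = r * a" "y = r * b" "z = r * c"
    by (rule exists_unit_vector)
  show ?thesis unfolding * r(3-5) mlog_bloch[OF r(2)] Let_def by (rule hermitian_bloch)
qed

text \<open>On the constraint set Tr \<sigma> = 1 and Tr \<sigma>H = E, so changing the exponent by
  a multiple of H alters the relative entropy only by a constant: l E plus the difference of the two
  log-partition constants.\<close>

lemma gibbs_shift:
  fixes G H :: "2 cmat"
  assumes G: "hermitian G" and H: "hermitian H"
  shows "\<exists>k. \<forall>\<sigma>\<in>constraint_set H E. rel_entropy \<sigma> (gibbs G) = rel_entropy \<sigma> (gibbs (G + l *\<^sub>R H)) + k"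
proof -
  obtain g0 g1 g2 g3 where G': "G = bloch g0 g1 g2 g3" using G by (rule hermitian_2_obtain)
  obtain h0 h1 h2 h3 where H': "H = bloch h0 h1 h2 h3" using H by (rule hermitian_2_obtain)
  have GH: "hermitian (G + l *\<^sub>R H)" unfolding G' H' bloch_scaleR bloch_add by (rule hermitian_bloch)
  obtain c where c: "mlog (gibbs G) = G - bloch c 0 0 0" using gibbs_2(3)[OF G] by auto
  obtain d where d: "mlog (gibbs (G + l *\<^sub>R H)) = G + l *\<^sub>R H - bloch d 0 0 0" using gibbs_2(3)[OF GH] by auto
  show ?thesis
  proof (intro exI[of _ "c - d + l * E"] ballI)
    fix \<sigma> assume \<sigma>: "\<sigma> \<in> constraint_set H E"
    then have "hermitian \<sigma>" by (simp add: constraint_set_def density_operator_def pos_semidef_def)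
    then obtain t x y z where s: "\<sigma> = bloch t x y z" by (rule hermitian_2_obtain)
    have t: "t = 1/2" using \<sigma> s trace_eq_1_bloch by (auto simp: constraint_set_def density_operator_def)
    obtain a0 a1 a2 a3 where a: "mlog \<sigma> = bloch a0 a1 a2 a3"
      using hermitian_mlog_2 \<open>hermitian \<sigma>\<close> hermitian_2_obtain by metis
    have "complex_of_real (2 * (t * h0 + x * h1 + y * h2 + z * h3)) = complex_of_real E"
      using \<sigma> unfolding constraint_set_def s H' trace_bloch_mult mem_Collect_eq by blast
    then have E: "E = 2 * (t * h0 + x * h1 + y * h2 + z * h3)" using of_real_eq_iff by metis
    show "rel_entropy \<sigma> (gibbs G) = rel_entropy \<sigma> (gibbs (G + l *\<^sub>R H)) + (c - d + l * E)"
      unfolding rel_entropy_def c d a E unfolding s G' H' bloch_diff bloch_add bloch_scaleR trace_bloch_mult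
      by (simp add: t field_simps)
  qed
qed

text \<open>After the constant shift, Klein's inequality makes the Gibbs state the strict minimizer.
  Uniqueness is essential: \<open>arg_min_on\<close> is a choice operator and can be evaluated only
  when the minimizer is unique.\<close>

lemma arg_min_gibbs:
  fixes G H :: "2 cmat"
  assumes G: "hermitian G" and H: "hermitian H" and mem: "gibbs (G + l *\<^sub>R H) \<in> constraint_set H E"
  shows "arg_min_on (\<lambda>\<sigma>. rel_entropy \<sigma> (gibbs G)) (constraint_set H E) = gibbs (G + l *\<^sub>R H)"
proof -
  let ?\<tau> = "gibbs (G + l *\<^sub>R H)"
  obtain k where k: "\<And>\<sigma>. \<sigma> \<in> constraint_set H E \<Longrightarrow> rel_entropy \<sigma> (gibbs G) = rel_entropy \<sigma> ?\<tau> + k"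
    using gibbs_shift[OF G H] by metis
  have "hermitian (G + l *\<^sub>R H)"
    using G H by (elim hermitian_2_obtain) (simp add: bloch_scaleR bloch_add hermitian_bloch)
  from gibbs_2(1,2)[OF this] have
    kl: "\<sigma> \<in> constraint_set H E \<Longrightarrow> 0 \<le> rel_entropy \<sigma> ?\<tau> \<and> (rel_entropy \<sigma> ?\<tau> = 0 \<longleftrightarrow> \<sigma> = ?\<tau>)" for \<sigma>
    using klein_qubit by (auto simp: constraint_set_def)
  have "is_arg_min (\<lambda>\<sigma>. rel_entropy \<sigma> (gibbs G)) (\<lambda>x. x \<in> constraint_set H E) ?\<tau>"
    unfolding is_arg_min_def using mem kl k by (smt (verit, best))
  moreover have "\<sigma> = ?\<tau>" if "is_arg_min (\<lambda>\<sigma>. rel_entropy \<sigma> (gibbs G)) (\<lambda>x. x \<in> constraint_set H E) \<sigma>" for \<sigma>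
    using that unfolding is_arg_min_def using mem kl k by (smt (verit, best))
  ultimately show ?thesis unfolding arg_min_on_def arg_min_def by (intro some_equality)
qed

text \<open>Here d is the length of the Bloch component orthogonal to H and m the component along H.
  The Gibbs state has Tr \<sigma>H = tanh(n) m / n with n = sqrt (d^2 + m^2), and the intermediate
  value theorem finds m where this equals E.\<close>

lemma exists_tanh_direction_nonneg:
  fixes d E :: real
  assumes "0 < d" "0 \<le> E" "E < 1"
  obtains m where "tanh (sqrt (d\<^sup>2 + m\<^sup>2)) * m = E * sqrt (d\<^sup>2 + m\<^sup>2)"
proof -
  define F where "F m = tanh (sqrt (d\<^sup>2 + m\<^sup>2)) * m - E * sqrt (d\<^sup>2 + m\<^sup>2)" for m
  have e: "sqrt E < 1" using assms by simp
  have "\<forall>\<^sub>F m in at_top. sqrt E < tanh (m :: real)"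
    using order_tendstoD(1)[OF tanh_real_at_top e] .
  then obtain m0 where m0: "sqrt E < tanh m0" by (auto simp: eventually_at_top_linorder)
  \<comment> \<open>The target E is split as sqrt E times sqrt E: \<open>m0\<close> makes the tanh
    factor at least sqrt E, and d / (1 - E) does the same for the ratio m / sqrt (d^2 +
    m^2).\<close>
  define m where "m = max (max m0 0) (d / (1 - E))"
  have m: "m0 \<le> m" "0 \<le> m" "d \<le> (1 - E) * m"
    using assms pos_divide_le_eq[of "1 - E" d m] by (auto simp: m_def mult.commute)
  have "E * (d\<^sup>2 + m\<^sup>2) \<le> m\<^sup>2"
  proof -
    have "d\<^sup>2 \<le> ((1 - E) * m)\<^sup>2" using m assms by (intro power_mono) auto
    also have "\<dots> = (1 - E) * ((1 - E) * m\<^sup>2)" by (simp add: power2_eq_square)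
    also have "\<dots> \<le> 1 * ((1 - E) * m\<^sup>2)" using assms by (intro mult_right_mono) auto
    finally have d: "d\<^sup>2 \<le> (1 - E) * m\<^sup>2" by simp
    have "E * d\<^sup>2 \<le> 1 * d\<^sup>2" using assms by (intro mult_right_mono) auto
    with d show ?thesis by (simp add: algebra_simps)
  qed
  then have "sqrt E * sqrt (d\<^sup>2 + m\<^sup>2) \<le> m"
    using m by (metis real_sqrt_le_iff real_sqrt_mult real_sqrt_abs abs_of_nonneg)
  moreover have "sqrt E \<le> tanh (sqrt (d\<^sup>2 + m\<^sup>2))"
  proof -
    have "m0 \<le> sqrt (d\<^sup>2 + m\<^sup>2)" using m by (meson order_trans real_sqrt_sum_squares_ge2)
    then show ?thesis using m0 tanh_real_le_iff by (smt (verit))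
  qed
  ultimately have "sqrt E * (sqrt E * sqrt (d\<^sup>2 + m\<^sup>2)) \<le> tanh (sqrt (d\<^sup>2 + m\<^sup>2)) * m"
    using assms m by (intro mult_mono) auto
  then have "0 \<le> F m" using assms by (simp add: F_def mult.assoc [symmetric])
  moreover have "F 0 \<le> 0" using assms by (simp add: F_def)
  moreover have "continuous_on {0..m} F"
    unfolding F_def by (intro continuous_intros) auto
  ultimately obtain x where "F x = 0" using IVT'[of F 0 0 m] m(2) by blast
  then show ?thesis using that[of x] by (simp add: F_def)
qed

text \<open>The second conclusion excludes the spurious solution d = m = 0, at which the equation
  reads 0 = 0 for every E. Negative E is reached by reflecting m.\<close>

lemma exists_tanh_direction:
  fixes d E :: real
  assumes "0 \<le> d" "-1 < E" "E < 1"
  obtains m where "tanh (sqrt (d\<^sup>2 + m\<^sup>2)) * m = E * sqrt (d\<^sup>2 + m\<^sup>2)" "d\<^sup>2 + m\<^sup>2 > 0 \<or> E = 0"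
proof (cases "d = 0")
  case True
  obtain m where m: "tanh m = E" using tanh_real_surj assms by metis
  then have "tanh \<bar>m\<bar> * m = E * \<bar>m\<bar>" by (auto simp: abs_if)
  moreover have "m \<noteq> 0 \<or> E = 0" using m by auto
  ultimately show ?thesis using that[of m] True by simp
next
  case False
  obtain m where m: "tanh (sqrt (d\<^sup>2 + m\<^sup>2)) * m = \<bar>E\<bar> * sqrt (d\<^sup>2 + m\<^sup>2)"
    using exists_tanh_direction_nonneg[of d "\<bar>E\<bar>"] False assms by fastforce
  have "d\<^sup>2 + x\<^sup>2 > 0" for x using False by (simp add: add_pos_nonneg)
  then show ?thesis using that[of "sgn E * m"] that[of m] that[of "-m"] m by (cases "0 \<le> E") auto
qed

lemma exists_gibbs_in_constraint_set:
  assumes G: "hermitian G" and h: "h1\<^sup>2 + h2\<^sup>2 + h3\<^sup>2 = 1" and E: "-1 < E" "E < 1"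
  obtains l where "gibbs (G + l *\<^sub>R bloch 0 h1 h2 h3) \<in> constraint_set (bloch 0 h1 h2 h3) E"
proof -
  obtain t x y z where G': "G = bloch t x y z" using G by (rule hermitian_2_obtain)
  \<comment> \<open>\<open>p\<close> is the component of the Bloch vector of G along H and
    \<open>d\<close> the length of the rest; adding l H with l = m - p changes the former to m and
    leaves the latter alone.\<close>
  define p where "p = x * h1 + y * h2 + z * h3"
  define d where "d = sqrt ((x - p * h1)\<^sup>2 + (y - p * h2)\<^sup>2 + (z - p * h3)\<^sup>2)"
  have d2: "d\<^sup>2 = (x - p * h1)\<^sup>2 + (y - p * h2)\<^sup>2 + (z - p * h3)\<^sup>2" "0 \<le> d" unfolding d_def by simp_all
  obtain m where m: "tanh (sqrt (d\<^sup>2 + m\<^sup>2)) * m = E * sqrt (d\<^sup>2 + m\<^sup>2)" "d\<^sup>2 + m\<^sup>2 > 0 \<or> E = 0"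
    using exists_tanh_direction[OF d2(2) E] by metis
  define l where "l = m - p"
  have hh: "h1 * h1 = 1 - h2 * h2 - h3 * h3" "h1 * (h1 * w) = (1 - h2 * h2 - h3 * h3) * w" for w
  proof -
    show "h1 * h1 = 1 - h2 * h2 - h3 * h3" using h by (simp add: power2_eq_square)
    then show "h1 * (h1 * w) = (1 - h2 * h2 - h3 * h3) * w" by (metis mult.assoc)
  qed
  obtain r a b c where r: "0 \<le> r" "a\<^sup>2 + b\<^sup>2 + c\<^sup>2 = 1" "x + l * h1 = r * a" "y + l * h2 = r * b"
    "z + l * h3 = r * c" "r\<^sup>2 = (x + l * h1)\<^sup>2 + (y + l * h2)\<^sup>2 + (z + l * h3)\<^sup>2"
    by (rule exists_unit_vector)
  have "r\<^sup>2 = d\<^sup>2 + m\<^sup>2"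
    unfolding r(6) d2(1) by (simp add: l_def p_def power2_eq_square algebra_simps hh)
  then have rs: "r = sqrt (d\<^sup>2 + m\<^sup>2)" using r(1) by (metis real_sqrt_abs abs_of_nonneg)
  have wh: "r * (a * h1 + b * h2 + c * h3) = m"
  proof -
    have "r * (a * h1 + b * h2 + c * h3) = r * a * h1 + r * b * h2 + r * c * h3"
      by (simp add: algebra_simps)
    also have "\<dots> = p + l * (h1\<^sup>2 + h2\<^sup>2 + h3\<^sup>2)"
      unfolding r(3-5) [symmetric] by (simp add: p_def power2_eq_square algebra_simps)
    finally show ?thesis using h by (simp add: l_def)
  qed
  have "tanh r * (a * h1 + b * h2 + c * h3) = E"
  proof (cases "r = 0")
    case True
    then show ?thesis using m(2) \<open>r\<^sup>2 = d\<^sup>2 + m\<^sup>2\<close> by auto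
  next
    case False
    have "tanh r * (r * (a * h1 + b * h2 + c * h3)) = E * r" using m(1) unfolding wh rs [symmetric] .
    then show ?thesis using False by simp
  qed
  then have Eq: "2 * (1/2 * 0 + tanh r / 2 * a * h1 + tanh r / 2 * b * h2 + tanh r / 2 * c * h3) = E"
    by (simp add: algebra_simps)
  let ?K = "G + l *\<^sub>R bloch 0 h1 h2 h3"
  have K: "?K = bloch t (r * a) (r * b) (r * c)" unfolding G' bloch_scaleR bloch_add r(3-5) by simp
  have "gibbs ?K = bloch (1/2) (tanh r / 2 * a) (tanh r / 2 * b) (tanh r / 2 * c)"
    unfolding K by (rule gibbs_bloch[OF r(2)])
  then have "trace (gibbs ?K ** bloch 0 h1 h2 h3) = complex_of_real E"
    using Eq by (simp only: trace_bloch_mult)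
  moreover have "density_operator (gibbs ?K)"
    using gibbs_2(2)[of ?K] unfolding K by (simp add: hermitian_bloch)
  ultimately show ?thesis using that unfolding constraint_set_def by blast
qed

section \<open>Tensor products and the objective\<close>

lemma sum_UNIV_prod: "(\<Sum>x\<in>(UNIV :: ('a::finite \<times> 'b::finite) set). f x) = (\<Sum>i\<in>UNIV. \<Sum>j\<in>UNIV. f (i, j))"
  unfolding UNIV_Times_UNIV [symmetric] sum.cartesian_product by (simp add: split_def)

lemma dagger_mult: "dagger (A ** B) = dagger B ** dagger A"
  by (simp add: dagger_def matrix_matrix_mult_def vec_eq_iff cnj_sum mult.commute)

lemma dagger_dagger [simp]: "dagger (dagger A) = A"
  by (simp add: vec_eq_iff)

lemma dagger_kron: "dagger (kron A B) = kron (dagger A) (dagger B)"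
  by (simp add: vec_eq_iff kron_def)

lemma kron_nth: "kron A B $ (i, k) $ (j, l) = A $ i $ j * B $ k $ l"
  by (simp add: kron_def)

lemma kron_mult:
  fixes A B :: "'a::finite cmat" and C D :: "'b::finite cmat"
  shows "kron A C ** kron B D = kron (A ** B) (C ** D)"
  by (simp add: vec_eq_iff kron_def matrix_matrix_mult_def sum_UNIV_prod sum_product)
     (simp add: mult_ac)

lemma kron_mat_1 [simp]: "kron (mat 1 :: 'a::finite cmat) (mat 1 :: 'b::finite cmat) = mat 1"
  by (auto simp: vec_eq_iff kron_def mat_def)

lemma unitary_kron:
  fixes A :: "'a::finite cmat" and B :: "'b::finite cmat"
  assumes "unitary A" "unitary B" shows "unitary (kron A B)"
  using assms by (simp add: unitary_def dagger_kron kron_mult)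

lemma unitary_mult:
  fixes A B :: "'a::finite cmat"
  assumes "unitary A" "unitary B" shows "unitary (A ** B)"
proof -
  have "dagger (A ** B) ** (A ** B) = dagger B ** (dagger A ** A) ** B"
    "(A ** B) ** dagger (A ** B) = A ** (B ** dagger B) ** dagger A"
    by (simp_all add: dagger_mult matrix_mul_assoc)
  then show ?thesis using assms by (simp add: unitary_def)
qed

lemma trace_mult_ptrace_B:
  fixes K :: "'a::finite cmat" and X :: "('a \<times> 'b::finite) cmat"
  shows "trace (K ** ptrace_B X) = trace (kron K (mat 1) ** X)"
proof -
  have "trace (kron K (mat 1) ** X) = (\<Sum>i\<in>UNIV. \<Sum>b\<in>UNIV. \<Sum>j\<in>UNIV. \<Sum>c\<in>UNIV. if b = c then K $ i $ j * X $ (j, c) $ (i, b) else 0)"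
    by (simp add: trace_def matrix_matrix_mult_def sum_UNIV_prod kron_def mat_def if_distrib if_distribR cong: if_cong)
  also have "\<dots> = (\<Sum>i\<in>UNIV. \<Sum>b\<in>UNIV. \<Sum>j\<in>UNIV. K $ i $ j * X $ (j, b) $ (i, b))"
    by simp
  also have "\<dots> = (\<Sum>i\<in>UNIV. \<Sum>j\<in>UNIV. \<Sum>b\<in>UNIV. K $ i $ j * X $ (j, b) $ (i, b))"
    by (intro sum.cong refl sum.swap)
  also have "\<dots> = trace (K ** ptrace_B X)"
    by (simp add: trace_def matrix_matrix_mult_def ptrace_B_def sum_distrib_left)
  finally show ?thesis ..
qed

lemma trace_dagger: "trace (dagger A) = cnj (trace A)"
  by (simp add: trace_def)

lemma trace_scaleR: "trace (c *\<^sub>R A) = c *\<^sub>R trace (A :: 'n::finite cmat)"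
  by (simp add: trace_def scaleR_sum_right)

lemma ptrace_B_add: "ptrace_B (X + Y) = ptrace_B X + ptrace_B Y"
  by (simp add: vec_eq_iff ptrace_B_def sum.distrib)

lemma ptrace_B_diff: "ptrace_B (X - Y) = ptrace_B X - ptrace_B Y"
  by (simp add: vec_eq_iff ptrace_B_def sum_subtractf)

lemma ptrace_B_scaleR: "ptrace_B (c *\<^sub>R X) = c *\<^sub>R ptrace_B X"
  by (simp add: vec_eq_iff ptrace_B_def scaleR_sum_right)

lemma matrix_diff_ldistrib: "A ** (B - C) = A ** B - A ** (C :: 'a::ring_1^'n^'m)"
  by (simp add: matrix_matrix_mult_def vec_eq_iff right_diff_distrib sum_subtractf)

lemma matrix_diff_rdistrib: "(A - B) ** C = A ** C - B ** (C :: 'a::ring_1^'n^'m)"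
  by (simp add: matrix_matrix_mult_def vec_eq_iff left_diff_distrib sum_subtractf)

text \<open>Cyclicity of the trace cancels \<open>\<rho>\<^sup>-\<^sup>1\<^sup>/\<^sup>2\<close> against one of the two factors \<open>\<rho>\<^sup>1\<^sup>/\<^sup>2\<close> of \<open>\<rho>\<close>.\<close>

lemma objective_eq_trace:
  fixes \<rho> :: "'a::finite cmat" and N1 N2 :: "'a cmat \<Rightarrow> 'b::finite cmat"
  assumes h: "hermitian \<rho>" and m: "mpow \<rho> (- 1/2) ** \<rho> = mpow \<rho> (1/2)"
  shows "complex_of_real (objective N1 N2 \<rho>) = trace (\<rho> ** Omega N1 N2 \<rho>)"
proof -
  let ?Y = "mlog (sandwich N1 \<rho>) - mlog (sandwich N2 \<rho>)"
  let ?R = "pow_A \<rho> (1/2) :: ('a \<times> 'b) cmat" and ?R' = "pow_A \<rho> (- 1/2) :: ('a \<times> 'b) cmat"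
  let ?O = "Omega1 N1 N2 \<rho>"
  have "trace (\<rho> ** ?O) = - trace (\<rho> ** ptrace_B (choi N1 ** ?R ** ?Y ** ?R'))"
    unfolding Omega1_def by (simp add: trace_def matrix_matrix_mult_def sum_negf)
  also have "trace (\<rho> ** ptrace_B (choi N1 ** ?R ** ?Y ** ?R')) = trace (kron \<rho> (mat 1) ** (choi N1 ** ?R ** ?Y ** ?R'))"
    by (rule trace_mult_ptrace_B)
  also have "\<dots> = trace (choi N1 ** ?R ** ?Y ** (?R' ** kron \<rho> (mat 1)))"
    by (subst trace_mul_sym) (simp add: matrix_mul_assoc)
  also have "?R' ** kron \<rho> (mat 1) = ?R" unfolding pow_A_def kron_mult using m by simp
  also have "trace (choi N1 ** ?R ** ?Y ** ?R) = trace (sandwich N1 \<rho> ** ?Y)"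
    unfolding sandwich_def by (subst trace_mul_sym) (simp add: matrix_mul_assoc)
  finally have 1: "trace (\<rho> ** ?O) = - trace (sandwich N1 \<rho> ** ?Y)" .
  \<comment> \<open>Since \<rho> is Hermitian, the adjoint half of Omega contributes the complex
    conjugate, so the average is the real part.\<close>
  have "trace (\<rho> ** dagger ?O) = trace (dagger (?O ** \<rho>))"
    using h by (simp add: dagger_mult hermitian_def)
  also have "\<dots> = cnj (trace (\<rho> ** ?O))" unfolding trace_dagger trace_mul_sym[of ?O] ..
  finally have 2: "trace (\<rho> ** dagger ?O) = cnj (trace (\<rho> ** ?O))" .
  have "trace (\<rho> ** Omega N1 N2 \<rho>) = (1/2) *\<^sub>R (trace (\<rho> ** ?O) + trace (\<rho> ** dagger ?O))"
    unfolding Omega_def matrix_scalar_ac scalar_matrix_assoc [symmetric] matrix_add_ldistrib trace_scaleR trace_add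
    by (simp add: scaleR_add_right)
  also have "\<dots> = complex_of_real (Re (trace (\<rho> ** ?O)))"
    unfolding 2 by (simp add: complex_add_cnj complex_eq_iff)
  finally show ?thesis unfolding 1 objective_def rel_entropy_def by simp
qed

section \<open>Powers of positive-definite matrices and the invariance of
  \<open>omega\<close>\<close>

lemma mpow_unitary_diag:
  "unitary U \<Longrightarrow> mpow (U ** real_diag d ** dagger U) s = U ** real_diag (\<lambda>i. d i powr s) ** dagger U"
  unfolding mpow_def by (rule herm_fun_eq)

lemma real_diag_mult: "real_diag a ** real_diag b = real_diag (\<lambda>i. a i * b i)"
  by (simp add: vec_eq_iff real_diag_mult_nth) (simp add: real_diag_def)

lemma unitary_conj_mult:
  fixes U :: "'n::finite cmat"
  assumes "unitary U"
  shows "(U ** A ** dagger U) ** (U ** B ** dagger U) = U ** (A ** B) ** dagger U"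
proof -
  have "(U ** A ** dagger U) ** (U ** B ** dagger U) = U ** A ** (dagger U ** U) ** B ** dagger U"
    by (simp only: matrix_mul_assoc)
  also have "dagger U ** U = mat 1" using assms by (simp add: unitary_def)
  finally show ?thesis by (simp only: matrix_mul_assoc matrix_mul_rid)
qed

lemma mpow_unitary_diag_mult:
  fixes U :: "'n::finite cmat"
  assumes "unitary U" "\<And>i. 0 < d i" and \<rho>: "\<rho> = U ** real_diag d ** dagger U"
  shows "mpow \<rho> s ** mpow \<rho> t = mpow \<rho> (s + t)" "mpow \<rho> 0 = mat 1" "mpow \<rho> 1 = \<rho>" "dagger (mpow \<rho> s) = mpow \<rho> s"
proof -
  have [simp]: "d i \<noteq> 0" "\<bar>d i\<bar> = d i" for i using assms(2)[of i] by auto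
  show "mpow \<rho> s ** mpow \<rho> t = mpow \<rho> (s + t)"
    unfolding \<rho> mpow_unitary_diag[OF assms(1)] unitary_conj_mult[OF assms(1)] real_diag_mult by (simp add: powr_add)
  have "real_diag (\<lambda>i. 1) = (mat 1 :: 'n cmat)" by (simp add: real_diag_def mat_def vec_eq_iff)
  then show "mpow \<rho> 0 = mat 1"
    unfolding \<rho> mpow_unitary_diag[OF assms(1)] using assms(1) by (simp add: unitary_def)
  show "mpow \<rho> 1 = \<rho>" unfolding \<rho> mpow_unitary_diag[OF assms(1)] by simp
  have "dagger (real_diag a) = (real_diag a :: 'n cmat)" for a by (simp add: vec_eq_iff real_diag_def)
  then show "dagger (mpow \<rho> s) = mpow \<rho> s"
    unfolding \<rho> mpow_unitary_diag[OF assms(1)] by (simp add: dagger_mult matrix_mul_assoc)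
qed

text \<open>The unnormalized maximally entangled projector, the Choi matrix of the identity channel.\<close>

definition omega :: "('a::finite \<times> 'a) cmat" where
  "omega = (\<chi> x y. if fst x = snd x \<and> fst y = snd y then 1 else 0)"

text \<open>\<open>transpose (dagger U)\<close> is the entrywise conjugate of U, and the invariance
  is the orthonormality of the rows of U.\<close>

lemma omega_invariant:
  fixes U :: "'a::finite cmat"
  assumes "unitary U"
  shows "kron U (transpose (dagger U)) ** omega = omega"
    "omega ** dagger (kron U (transpose (dagger U))) = omega"
proof -
  have 0: "(\<Sum>k\<in>UNIV. U $ i $ k * cnj (U $ j $ k)) = (if i = j then 1 else 0)" for i j
  proof -
    have "(U ** dagger U) $ i $ j = mat 1 $ i $ j" using assms by (simp add: unitary_def)
    then show ?thesis by (simp add: matrix_matrix_mult_def mat_def)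
  qed
  have *: "(\<Sum>k\<in>UNIV. \<Sum>l\<in>UNIV. U $ i $ k * cnj (U $ j $ l) * (if k = l then 1 else 0)) = (if i = j then 1 else 0)" for i j
    unfolding 0 [of i j, symmetric] by (simp add: if_distrib sum.delta cong: if_cong)
  show 1: "kron U (transpose (dagger U)) ** omega = omega"
  proof -
    have "(kron U (transpose (dagger U)) ** omega) $ x $ y = omega $ x $ y" for x y
    proof (cases "fst y = snd y")
      case True
      then have "(kron U (transpose (dagger U)) ** omega) $ x $ y =
        (\<Sum>k\<in>UNIV. \<Sum>l\<in>UNIV. U $ fst x $ k * cnj (U $ snd x $ l) * (if k = l then 1 else 0))"
        by (simp add: matrix_matrix_mult_def sum_UNIV_prod kron_def omega_def transpose_def)
      then show ?thesis unfolding * using True by (simp add: omega_def)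
    qed (simp add: matrix_matrix_mult_def omega_def)
    then show ?thesis by (simp add: vec_eq_iff)
  qed
  have "dagger omega = (omega :: ('a \<times> 'a) cmat)" by (simp add: vec_eq_iff omega_def conj_commute)
  then show "omega ** dagger (kron U (transpose (dagger U))) = omega"
    using arg_cong[OF 1, of dagger] by (simp add: dagger_mult)
qed

lemma unitary_transpose_dagger:
  fixes U :: "'a::finite cmat"
  assumes "unitary U" shows "unitary (transpose (dagger U))"
proof -
  have e: "dagger (transpose (dagger U)) = transpose U" by (simp add: vec_eq_iff transpose_def)
  show ?thesis unfolding unitary_def e
    using assms by (simp add: matrix_transpose_mul [symmetric] unitary_def transpose_mat)
qed

section \<open>The logarithms of the sandwiched Choi matrices\<close>

text \<open>\<open>blk X a b\<close> acts as \<open>X\<close> on the span of \<open>|11\<rangle>, |22\<rangle>\<close> and as \<open>a\<close>, \<open>b\<close> on \<open>|12\<rangle>\<close>, \<open>|21\<rangle>\<close>.\<close>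

definition blk :: "2 cmat \<Rightarrow> real \<Rightarrow> real \<Rightarrow> (2 \<times> 2) cmat" where
  "blk X a b = (\<chi> x y. if fst x = snd x \<and> fst y = snd y then X $ fst x $ fst y
     else if x = y then complex_of_real (if fst x = 1 then a else b) else 0)"

lemma mat22_eq_iff: "(A :: (2 \<times> 2) cmat) = B \<longleftrightarrow>
    (\<forall>i j k l. A $ (i, j) $ (k, l) = B $ (i, j) $ (k, l))"
  by (simp add: vec_eq_iff split_paired_All)

lemma mult_nth_22: "((A :: (2 \<times> 2) cmat) ** B) $ x $ y = A $ x $ (1,1) * B $ (1,1) $ y + A $ x $ (1,2) * B $ (1,2) $ y
   + A $ x $ (2,1) * B $ (2,1) $ y + A $ x $ (2,2) * B $ (2,2) $ y"
  by (simp add: matrix_matrix_mult_def sum_UNIV_prod sum_2)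

lemma blk_mult: "blk X a b ** blk Y c d = blk (X ** Y) (a * c) (b * d)"
  unfolding mat22_eq_iff mult_nth_22 forall_2 by (simp add: blk_def mult_nth_2)

lemma dagger_blk: "dagger (blk X a b) = blk (dagger X) a b"
  by (simp add: mat22_eq_iff forall_2 blk_def)

lemma blk_mat_1: "blk (mat 1) 1 1 = mat 1"
  by (simp add: mat22_eq_iff forall_2 blk_def mat_def)

lemma blk_0: "blk 0 0 0 = 0"
  by (simp add: mat22_eq_iff forall_2 blk_def)

lemma blk_real_diag: "blk (real_diag d) a b = real_diag (\<lambda>x. if fst x = snd x then d (fst x) else if fst x = 1 then a else b)"
  by (simp add: mat22_eq_iff forall_2 blk_def real_diag_def)

lemma unitary_blk: "unitary R \<Longrightarrow> unitary (blk R 1 1)"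
  by (simp add: unitary_def dagger_blk blk_mult blk_mat_1)

lemma spectral_2:
  fixes X :: "2 cmat"
  assumes "hermitian X"
  obtains U d where "unitary U" "X = U ** real_diag d ** dagger U"
proof -
  obtain t x y z where X: "X = bloch t x y z" using assms by (rule hermitian_2_obtain)
  obtain r a b c where r: "0 \<le> r" "a\<^sup>2 + b\<^sup>2 + c\<^sup>2 = 1" "x = r * a" "y = r * b" "z = r * c"
    by (rule exists_unit_vector)
  obtain U :: "2 cmat" where U: "unitary U" and
    s: "\<And>d. U ** real_diag d ** dagger U =
       bloch ((d 1 + d 2) / 2) ((d 1 - d 2) / 2 * a) ((d 1 - d 2) / 2 * b) ((d 1 - d 2) / 2 * c)"
    using qubit_spectral[OF r(2)] by metis
  have "X = U ** real_diag (\<lambda>i. if i = 1 then t + r else t - r) ** dagger U"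
    unfolding s X r(3-5) by simp
  then show ?thesis using that U by blast
qed

text \<open>An eigenbasis of X inside the span of |11> and |22>, completed by |12> and |21>,
  diagonalizes the whole block matrix.\<close>

lemma herm_fun_blk:
  assumes V: "unitary V" and X: "hermitian X"
  shows "herm_fun f (V ** blk X a b ** dagger V) = V ** blk (herm_fun f X) (f a) (f b) ** dagger V"
proof -
  obtain R d where R: "unitary R" "X = R ** real_diag d ** dagger R" using X by (rule spectral_2)
  let ?e = "\<lambda>x :: 2 \<times> 2. if fst x = snd x then d (fst x) else if fst x = 1 then a else b"
  have *: "V ** blk (R ** Y ** dagger R) a b ** dagger V = (V ** blk R 1 1) ** blk Y a b ** dagger (V ** blk R 1 1)"
    for Y a b by (simp add: dagger_mult dagger_blk matrix_mul_assoc [symmetric])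
      (simp add: matrix_mul_assoc blk_mult)
  have f: "(\<lambda>x. f (?e x)) = (\<lambda>x. if fst x = snd x then f (d (fst x)) else if fst x = 1 then f a else f b)"
    by auto
  show ?thesis
    unfolding R(2) herm_fun_eq[OF R(1)] * blk_real_diag herm_fun_eq[OF unitary_mult[OF V unitary_blk[OF R(1)]]] f ..
qed

text \<open>The identity on the second factor forces equal second indices, so between |11> and |22>
  only the diagonal of R survives. This is why the dephasing logarithm sees only the diagonal of the
  state.\<close>

lemma blk_kron_blk: "blk X 0 0 ** kron R (mat 1) ** blk Y 0 0 = blk (X ** (\<chi> i j. if i = j then R $ i $ i else 0) ** Y) 0 0"
  unfolding mat22_eq_iff mult_nth_22 forall_2 by (simp add: blk_def mult_nth_2 kron_nth mat_def)

lemma blk_0_kron_blk_0: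
  "blk 0 a b ** kron (bloch t x y z) (mat 1) ** blk 0 c d = blk 0 (a * (t + z) * c) (b * (t - z) * d)"
  unfolding mat22_eq_iff mult_nth_22 forall_2 by (simp add: blk_def mult_nth_2 kron_nth mat_def)

lemma ptrace_B_blk: "ptrace_B (blk Y 0 0) = (\<chi> i j. if i = j then Y $ i $ i else 0)"
  by (simp add: mat2_eq_iff ptrace_B_def sum_2 blk_def)

text \<open>Conjugation by sigma_z flips the sign of off-diagonal matrix units, leaving the
  coherence q - (1 - q).\<close>

lemma choi_dephasing: "choi (dephasing q) = blk (bloch 1 (2 * q - 1) 0 0) 0 0"
  unfolding mat22_eq_iff forall_2 choi_def sum_2
  by (simp add: kron_nth mat_unit_def dephasing_def sigma_bloch mult_nth_2 blk_def complex_eq_iff)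

lemma choi_depolarizing: "choi (depolarizing p) = (1 - p) *\<^sub>R omega + (p / 2) *\<^sub>R mat 1"
  unfolding mat22_eq_iff forall_2 choi_def sum_2
  by (simp add: kron_nth mat_unit_def depolarizing_def mat_def trace_2 omega_def complex_eq_iff)

text \<open>Half the difference of the logarithms of c + R and c - R is artanh (R / c). The scalar
  part stays existential because it ends up only in the identity component of Omega.\<close>

lemma mlog_bloch_artanh:
  assumes "0 < R" "R < c" "R\<^sup>2 = x\<^sup>2 + y\<^sup>2 + z\<^sup>2"
  shows "\<exists>l. mlog (bloch c x y z) = bloch l (artanh (R / c) / R * x) (artanh (R / c) / R * y) (artanh (R / c) / R * z)"
proof -
  have u: "(x / R)\<^sup>2 + (y / R)\<^sup>2 + (z / R)\<^sup>2 = 1"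
    unfolding power_divide add_divide_distrib [symmetric] assms(3) [symmetric] using assms(1) by simp
  have "(1 + R / c) / (1 - R / c) = (c + R) / (c - R)" using assms by (simp add: field_simps)
  then have a: "artanh (R / c) = (ln (c + R) - ln (c - R)) / 2"
    using assms by (simp add: artanh_def ln_div)
  have "mlog (bloch c x y z) = bloch ((ln (c + R) + ln (c - R)) / 2) (artanh (R / c) * (x / R)) (artanh (R / c) * (y / R)) (artanh (R / c) * (z / R))"
    using mlog_bloch[OF u, of c R] assms(1,2) unfolding Let_def a by simp
  then show ?thesis by (intro exI[of _ "(ln (c + R) + ln (c - R)) / 2"]) simp
qed

definition diag2 :: "real \<Rightarrow> real \<Rightarrow> 2 cmat" where
  "diag2 a b = real_diag (\<lambda>i. if i = 1 then a else b)"

lemma diag2_nth [simp]: "diag2 a b $ 1 $ 1 = a" "diag2 a b $ 1 $ 2 = 0" "diag2 a b $ 2 $ 1 = 0" "diag2 a b $ 2 $ 2 = b"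
  by (simp_all add: diag2_def real_diag_def)

lemma diag2_mult: "diag2 a b ** diag2 c d = diag2 (a * c) (b * d)"
  by (simp add: mat2_eq_iff mult_nth_2)

lemma diag2_1: "diag2 1 1 = mat 1"
  by (simp add: mat2_eq_iff mat_def)

lemma dagger_diag2: "dagger (diag2 a b) = diag2 a b"
  by (simp add: mat2_eq_iff)

lemma dagger_mat_1: "dagger (mat 1) = mat 1"
  by (simp add: vec_eq_iff mat_def)

lemma dagger_add: "dagger (A + B) = dagger A + dagger B"
  by (simp add: vec_eq_iff)

lemma dagger_diff: "dagger (A - B) = dagger A - dagger B"
  by (simp add: vec_eq_iff)

lemma matrix_add_rdistrib: "(A + B) ** C = A ** C + B ** (C :: 'a::semiring_1^'n^'m)"
  by (simp add: matrix_matrix_mult_def vec_eq_iff distrib_right sum.distrib)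

text \<open>The logarithm has the form P L P with P = \<open>\<rho>\<^sup>1\<^sup>/\<^sup>2\<close>
  \<otimes> I. The outer powers combine with these factors to \<rho> \<otimes> I on the left of L
  and to the identity on its right, and compression reduces \<rho> \<otimes> I to its
  diagonal.\<close>

lemma ptrace_log_dephasing:
  fixes \<rho> :: "2 cmat"
  assumes QQ: "mpow \<rho> (1/2) ** mpow \<rho> (1/2) = \<rho>" "mpow \<rho> (1/2) ** mpow \<rho> (-1/2) = mat 1"
    "mpow \<rho> (-1/2) ** mpow \<rho> (1/2) = mat 1" "mpow \<rho> (-1/2) ** mpow \<rho> (-1/2) = bloch t' x' y' z'"
    and dQ: "dagger (mpow \<rho> (1/2)) = mpow \<rho> (1/2)" "dagger (mpow \<rho> (-1/2)) = mpow \<rho> (-1/2)"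
    and t': "t' + z' > 0" "t' - z' > 0"
    and \<rho>: "\<rho> = bloch (1/2) x y w" and w: "\<bar>w\<bar> < 1/2" and q: "0 < q" "q < 1" "q \<noteq> 1/2"
    and g: "g = 2 * q - 1" and R: "R = sqrt (g\<^sup>2 * (1/4 - w\<^sup>2) + w\<^sup>2)"
  shows "\<exists>l. ptrace_B (choi (dephasing q) ** pow_A \<rho> (1/2) ** mlog (sandwich (dephasing q) \<rho>) ** pow_A \<rho> (-1/2))
     = bloch l 0 0 (artanh (2 * R) / R * w * (1 - g\<^sup>2))"
proof -
  let ?Q = "mpow \<rho> (1/2)" and ?Q' = "mpow \<rho> (-1/2)"
  let ?P = "kron ?Q (mat 1) :: (2 \<times> 2) cmat" and ?P' = "kron ?Q' (mat 1) :: (2 \<times> 2) cmat"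
  define A1 A2 where "A1 = 1/2 + w" and "A2 = 1/2 - w"
  have A: "A1 > 0" "A2 > 0" using w by (auto simp: A1_def A2_def)
  have [simp]: "sqrt A1 * sqrt A1 = A1" "sqrt A2 * sqrt A2 = A2" using A by auto
  have sA: "sqrt A1 * (sqrt A1 * k) = A1 * k" "sqrt A2 * (sqrt A2 * k) = A2 * k" for k
    using A by (simp_all only: mult.assoc [symmetric]) simp_all
  define Di Dh where "Di = diag2 (1 / sqrt A1) (1 / sqrt A2)" and "Dh = diag2 (sqrt A1) (sqrt A2)"
  have DD: "Di ** Dh = mat 1" "Dh ** Di = mat 1"
    using A by (simp_all add: Di_def Dh_def diag2_mult diag2_1)
  \<comment> \<open>Normalizing factors: the vectors
    \<open>\<rho>\<^sup>-\<^sup>1\<^sup>/\<^sup>2\<close>|1>|2> and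
    \<open>\<rho>\<^sup>-\<^sup>1\<^sup>/\<^sup>2\<close>|2>|1> have as squared norms the diagonal
    entries of the inverse state \<open>bloch t' x' y' z'\<close>.\<close>
  define c1 c2 where "c1 = 1 / sqrt (t' + z')" and "c2 = 1 / sqrt (t' - z')"
  have c: "c1 * (t' + z') * c1 = 1" "c2 * (t' - z') * c2 = 1"
    using t' by (simp_all add: c1_def c2_def)
  have diag\<rho>: "(\<chi> i j. if i = j then \<rho> $ i $ i else 0) = diag2 A1 A2"
    by (simp add: mat2_eq_iff \<rho> A1_def A2_def)
  have PP: "?P ** ?P = kron \<rho> (mat 1)" "?P ** ?P' = mat 1" "?P' ** ?P = mat 1"
      "?P' ** ?P' = kron (bloch t' x' y' z') (mat 1)"
    using QQ by (simp_all add: kron_mult)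
  have dP: "dagger ?P = ?P" "dagger ?P' = ?P'"
    using dQ by (simp_all add: dagger_kron dagger_mat_1)
  \<comment> \<open>The columns \<open>\<rho>\<^sup>1\<^sup>/\<^sup>2|s\<rangle>|s\<rangle>\<close> span the support of the sandwiched matrix; \<open>\<rho>\<^sup>-\<^sup>1\<^sup>/\<^sup>2|s\<rangle>|t\<rangle>\<close>, \<open>s \<noteq> t\<close>,
    are orthogonal to them and to each other.\<close>
  define V where "V = ?P ** blk Di 0 0 + ?P' ** blk 0 c1 c2"
  have dV: "dagger V = blk Di 0 0 ** ?P + blk 0 c1 c2 ** ?P'"
    unfolding V_def dagger_add dagger_mult dagger_blk dP by (simp add: Di_def dagger_diag2) (simp add: dagger_def vec_eq_iff zero_vec_def)
  have zero: "A ** (0 :: (2 \<times> 2) cmat) = 0" for A :: "(2 \<times> 2) cmat"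
    by (simp add: vec_eq_iff matrix_matrix_mult_def)
  have zero': "(0 :: (2 \<times> 2) cmat) ** A = 0" for A :: "(2 \<times> 2) cmat"
    by (simp add: vec_eq_iff matrix_matrix_mult_def)
  have blk0: "blk X 0 0 ** blk 0 a b = 0" "blk 0 a b ** blk X 0 0 = 0" for X a b
    by (simp_all add: blk_mult blk_0)
  have "dagger V ** V = mat 1"
  proof -
    have "(blk Di 0 0 ** ?P) ** (?P ** blk Di 0 0) = blk Di 0 0 ** (?P ** ?P) ** blk Di 0 0"
      by (simp only: matrix_mul_assoc)
    also have "\<dots> = blk (mat 1) 0 0"
      unfolding PP blk_kron_blk diag\<rho> using A by (simp add: Di_def diag2_mult diag2_1)
    finally have 1: "(blk Di 0 0 ** ?P) ** (?P ** blk Di 0 0) = blk (mat 1) 0 0" .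
    have "(blk Di 0 0 ** ?P) ** (?P' ** blk 0 c1 c2) = blk Di 0 0 ** (?P ** ?P') ** blk 0 c1 c2"
      by (simp only: matrix_mul_assoc)
    then have 2: "(blk Di 0 0 ** ?P) ** (?P' ** blk 0 c1 c2) = 0"
      unfolding PP by (simp add: blk0)
    have "(blk 0 c1 c2 ** ?P') ** (?P ** blk Di 0 0) = blk 0 c1 c2 ** (?P' ** ?P) ** blk Di 0 0"
      by (simp only: matrix_mul_assoc)
    then have 3: "(blk 0 c1 c2 ** ?P') ** (?P ** blk Di 0 0) = 0"
      unfolding PP by (simp add: blk0)
    have "(blk 0 c1 c2 ** ?P') ** (?P' ** blk 0 c1 c2) = blk 0 c1 c2 ** (?P' ** ?P') ** blk 0 c1 c2"
      by (simp only: matrix_mul_assoc)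
    then have 4: "(blk 0 c1 c2 ** ?P') ** (?P' ** blk 0 c1 c2) = blk 0 1 1"
      unfolding PP blk_0_kron_blk_0 c .
    have "dagger V ** V = blk (mat 1) 0 0 + blk 0 1 1"
      unfolding dV unfolding V_def matrix_add_ldistrib matrix_add_rdistrib 1 2 3 4 by simp
    also have "\<dots> = mat 1" by (simp add: mat22_eq_iff forall_2 blk_def mat_def)
    finally show ?thesis .
  qed
  then have V: "unitary V" unfolding unitary_def using matrix_left_right_inverse by blast
  have conj: "V ** blk X 0 0 ** dagger V = ?P ** blk (Di ** X ** Di) 0 0 ** ?P" for X
  proof -
    have "V ** blk X 0 0 = ?P ** blk (Di ** X) 0 0"
      unfolding V_def matrix_add_rdistrib by (simp add: matrix_mul_assoc [symmetric] blk0 zero blk_mult blk_0)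
    then have "V ** blk X 0 0 ** dagger V = ?P ** (blk (Di ** X) 0 0 ** blk Di 0 0) ** ?P + ?P ** (blk (Di ** X) 0 0 ** blk 0 c1 c2) ** ?P'"
      unfolding dV matrix_add_ldistrib by (simp add: matrix_mul_assoc)
    then show ?thesis by (simp add: blk_mult blk_0 zero zero')
  qed
  \<comment> \<open>The matrix of the sandwiched operator on its support, in the orthonormal basis
    given by the first block of columns of \<open>V\<close>.\<close>
  define X where "X = Dh ** bloch 1 g 0 0 ** Dh"
  have "Di ** X ** Di = (Di ** Dh) ** bloch 1 g 0 0 ** (Dh ** Di)" by (simp only: X_def matrix_mul_assoc)
  then have S: "sandwich (dephasing q) \<rho> = V ** blk X 0 0 ** dagger V"
    unfolding conj sandwich_def pow_A_def choi_dephasing DD g by simp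
  have X: "X = bloch (1/2) (g * sqrt (A1 * A2)) 0 w"
    unfolding X_def Dh_def
    by (simp add: mat2_eq_iff mult_nth_2 complex_eq_iff real_sqrt_mult) (use A in \<open>simp add: A1_def A2_def\<close>)
  \<comment> \<open>g \<noteq> 0 keeps R positive even at w = 0, and g^2 < 1 keeps R below 1/2, so
    \<open>X\<close> is positive definite and the artanh formula applies.\<close>
  have g1: "g\<^sup>2 < 1" "g\<^sup>2 > 0" using q unfolding g by (auto simp: abs_square_less_1)
  have w2: "w\<^sup>2 < 1/4" using w abs_le_square_iff[of "1/2" w] by (auto simp: power2_eq_square not_le)
  have "0 < g\<^sup>2 * (1/4 - w\<^sup>2)" using g1 w2 by simp
  then have Rp: "0 < g\<^sup>2 * (1/4 - w\<^sup>2) + w\<^sup>2" by (smt (verit) zero_le_power2)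
  have "g\<^sup>2 * (1/4 - w\<^sup>2) < 1 * (1/4 - w\<^sup>2)" using g1 w2 by (intro mult_strict_right_mono) auto
  then have "g\<^sup>2 * (1/4 - w\<^sup>2) + w\<^sup>2 < (1/2)\<^sup>2" by (simp add: power2_eq_square)
  then have R2: "R\<^sup>2 < (1/2)\<^sup>2" "0 < R" using Rp by (simp_all add: R)
  then have R3: "R < 1/2" using power2_less_imp_less[of R "1/2"] by simp
  have "R\<^sup>2 = (g * sqrt (A1 * A2))\<^sup>2 + 0\<^sup>2 + w\<^sup>2"
    using Rp A by (simp add: R power_mult_distrib) (simp add: A1_def A2_def power2_eq_square algebra_simps)
  from mlog_bloch_artanh[OF R2(2) R3 this] obtain l \<tau> where \<tau>: "\<tau> = artanh (2 * R) / R"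
    and lX: "mlog X = bloch l (\<tau> * (g * sqrt (A1 * A2))) 0 (\<tau> * w)" unfolding X by (auto simp: mult.commute)
  \<comment> \<open>The two zero eigenvalues stay zero because the logarithm is set to 0 on the
    kernel.\<close>
  have L: "mlog (sandwich (dephasing q) \<rho>) = ?P ** blk (Di ** mlog X ** Di) 0 0 ** ?P"
    unfolding S conj [symmetric] unfolding mlog_def
    by (subst herm_fun_blk[OF V]) (simp_all add: X hermitian_bloch)
  let ?G = "bloch 1 g 0 0"
  have "choi (dephasing q) ** pow_A \<rho> (1/2) ** mlog (sandwich (dephasing q) \<rho>) ** pow_A \<rho> (-1/2)
    = blk ?G 0 0 ** (?P ** ?P) ** blk (Di ** mlog X ** Di) 0 0 ** (?P ** ?P')"
    unfolding L pow_A_def choi_dephasing g by (simp only: matrix_mul_assoc)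
  also have "\<dots> = blk (?G ** diag2 A1 A2 ** (Di ** mlog X ** Di)) 0 0"
    unfolding PP blk_kron_blk diag\<rho> by simp
  finally have "ptrace_B (choi (dephasing q) ** pow_A \<rho> (1/2) ** mlog (sandwich (dephasing q) \<rho>) ** pow_A \<rho> (-1/2))
    = (\<chi> i j. if i = j then (?G ** diag2 A1 A2 ** (Di ** mlog X ** Di)) $ i $ i else 0)"
    unfolding ptrace_B_blk [symmetric] by simp
  also have "\<dots> = diag2 (l + \<tau> * w + g\<^sup>2 * \<tau> * A2) (l - \<tau> * w + g\<^sup>2 * \<tau> * A1)"
    using A unfolding lX Di_def
    by (simp add: mat2_eq_iff mult_nth_2 complex_eq_iff real_sqrt_mult power2_eq_square field_simps sA)
  also have "\<dots> = bloch (l + g\<^sup>2 * \<tau> / 2) 0 0 (\<tau> * w * (1 - g\<^sup>2))"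
    by (simp add: mat2_eq_iff complex_eq_iff A1_def A2_def algebra_simps)
  finally show ?thesis unfolding \<tau> by blast
qed

lemma mpow_unitary_diag2:
  assumes "unitary U"
  shows "mpow (U ** diag2 a b ** dagger U) s = U ** diag2 (a powr s) (b powr s) ** dagger U"
  unfolding diag2_def mpow_unitary_diag[OF assms] by (simp add: if_distrib[of "\<lambda>x. x powr s"])

text \<open>
  Written this way, every summand transforms simply under conjugation by \<open>U \<otimes> cnj U\<close>,
  which fixes \<open>omega\<close>.
\<close>

lemma blk_conj_decomposition:
  fixes s1 s2 l y b :: real
  assumes "s1 \<noteq> 0" "s2 \<noteq> 0"
  defines "k1 \<equiv> s1 * y * (1 / s2)" and "k2 \<equiv> s2 * y * (1 / s1)"
  defines "e1 \<equiv> l + b - k1" and "e2 \<equiv> l - b - k2"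
  shows "kron (diag2 s1 s2) (mat 1) ** blk (bloch l y 0 b) la lb ** kron (diag2 (1 / s1) (1 / s2)) (mat 1) =
     ((e1 + e2 + la + lb) / 4) *\<^sub>R mat 1 + ((e1 + e2 - la - lb) / 4) *\<^sub>R kron (diag2 1 (-1)) (diag2 1 (-1))
     + ((e1 - e2 + la - lb) / 4) *\<^sub>R kron (diag2 1 (-1)) (mat 1) + ((e1 - e2 - la + lb) / 4) *\<^sub>R kron (mat 1) (diag2 1 (-1))
     + kron (diag2 k1 k2) (mat 1) ** omega" (is "?L = ?R")
proof -
  define M where "M = (vector [vector [complex_of_real (l + b), complex_of_real k1], vector [complex_of_real k2, complex_of_real (l - b)]] :: 2 cmat)"
  have M: "M $ 1 $ 1 = l + b" "M $ 1 $ 2 = k1" "M $ 2 $ 1 = k2" "M $ 2 $ 2 = l - b" by (simp_all add: M_def)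
  have "?L = blk M la lb"
    unfolding mat22_eq_iff mult_nth_22 forall_2
    using assms(1,2) by (simp add: kron_nth mat_def blk_def complex_eq_iff M k1_def k2_def)
  also have "\<dots> = ?R"
    unfolding mat22_eq_iff forall_2
    by (simp add: kron_nth mat_def blk_def complex_eq_iff M mult_nth_22 omega_def e1_def e2_def)
      (simp add: field_simps)
  finally show ?thesis .
qed

text \<open>Conjugation by W = U \<otimes> conj U fixes the depolarizing Choi matrix and reduces its
  logarithm to a diagonal state. The dephasing Choi matrix is not fixed, so W is applied to the
  logarithm term by term before the two are multiplied.\<close>

lemma ptrace_log_depolarizing:
  fixes U \<rho> :: "2 cmat"
  assumes U: "unitary U"
    and s: "\<And>a b. U ** diag2 a b ** dagger U = bloch ((a + b) / 2) ((a - b) / 2 * x) ((a - b) / 2 * y) ((a - b) / 2 * z)"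
    and d: "0 < d1" "0 < d2" "d1 + d2 = 1" and \<rho>: "\<rho> = U ** diag2 d1 d2 ** dagger U"
    and p: "0 < p" "p < 1" and g: "g = 2 * q - 1" and u: "u = 1 - p / 2" and v: "v = 1 - p" and r: "r = d1 - d2"
    and R: "R = sqrt (v\<^sup>2 * (d1 * d2) + u\<^sup>2 * r\<^sup>2 / 4)" and t: "t = artanh (R / (u / 2)) / R"
    and X: "X = ptrace_B (choi (dephasing q) ** pow_A \<rho> (1/2) ** mlog (sandwich (depolarizing p) \<rho>) ** pow_A \<rho> (-1/2))"
    and \<kappa>: "\<kappa> = t * r * (u - v) * (1 + g) / 4 + (ln d1 - ln d2) * (1 - g) / 4"
    and \<zeta>: "\<zeta> = r / 2 * t * (u - g * v)"
  shows "\<exists>\<alpha>. X + dagger X = 2 *\<^sub>R bloch \<alpha> (\<kappa> * x) (\<kappa> * y) (\<zeta> * z)"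
proof -
  define Uc where "Uc = transpose (dagger U)"
  define W where "W = kron U Uc"
  have Uc: "unitary Uc" unfolding Uc_def by (rule unitary_transpose_dagger[OF U])
  have W: "unitary W" unfolding W_def by (rule unitary_kron[OF U Uc])
  have dW: "dagger W = kron (dagger U) (dagger Uc)" unfolding W_def by (rule dagger_kron)
  have Wk: "W ** kron A B ** dagger W = kron (U ** A ** dagger U) (Uc ** B ** dagger Uc)" for A B
    unfolding dW unfolding W_def kron_mult ..
  have UcI: "Uc ** mat 1 ** dagger Uc = mat 1" "W ** mat 1 ** dagger W = mat 1"
    using Uc W by (simp_all add: unitary_def)
  have UI: "U ** mat 1 ** dagger U = mat 1" using U by (simp add: unitary_def)
  have W\<omega>: "W ** omega ** dagger W = omega"
    using omega_invariant[OF U] unfolding W_def Uc_def by simp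
  have P: "pow_A \<rho> k = W ** kron (diag2 (d1 powr k) (d2 powr k)) (mat 1) ** dagger W" for k
    unfolding Wk UcI pow_A_def \<rho> mpow_unitary_diag2[OF U] ..
  have C: "choi (depolarizing p) = W ** choi (depolarizing p) ** dagger W"
    unfolding choi_depolarizing
    by (simp add: matrix_add_ldistrib matrix_add_rdistrib matrix_scalar_ac scalar_matrix_assoc [symmetric] W\<omega> UcI
        del: matrix_mul_rid)
  have sq: "d1 powr (1/2) = sqrt d1" "d2 powr (1/2) = sqrt d2" "d1 powr (-1/2) = 1 / sqrt d1" "d2 powr (-1/2) = 1 / sqrt d2"
    using d powr_minus_divide[of d1 "1/2"] powr_minus_divide[of d2 "1/2"] by (simp_all add: powr_half_sqrt)
  have [simp]: "sqrt d1 * sqrt d1 = d1" "sqrt d2 * sqrt d2 = d2" using d by auto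
  have d2: "d2 = 1 - d1" using d by simp
  \<comment> \<open>The block of the sandwiched matrix on |11> and |22> when the state is diag (d1,
    d2); its eigenvalues are u / 2 + R and u / 2 - R.\<close>
  define B where "B = bloch (u / 2) (v * sqrt (d1 * d2)) 0 (u * r / 2)"
  define D D' where "D = diag2 (sqrt d1) (sqrt d2)" and "D' = diag2 (1 / sqrt d1) (1 / sqrt d2)"
  have "kron D (mat 1) ** choi (depolarizing p) ** kron D (mat 1) = blk B (p / 2 * d1) (p / 2 * d2)"
    unfolding choi_depolarizing mat22_eq_iff mult_nth_22 forall_2 D_def
    using d by (simp add: kron_nth mat_def omega_def blk_def B_def complex_eq_iff u v r real_sqrt_mult)
      (simp add: d2 field_simps)
  then have S: "sandwich (depolarizing p) \<rho> = W ** blk B (p / 2 * d1) (p / 2 * d2) ** dagger W"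
    unfolding sandwich_def P sq D_def [symmetric] by (subst C) (simp add: unitary_conj_mult[OF W])
  have uv: "0 < v" "v < u" using p by (auto simp: u v)
  have dd: "4 * (d1 * d2) + r\<^sup>2 = 1"
  proof -
    have "4 * (d1 * d2) + r\<^sup>2 = (d1 + d2)\<^sup>2" by (simp add: r power2_eq_square algebra_simps)
    then show ?thesis using d by simp
  qed
  have Rp: "0 < v\<^sup>2 * (d1 * d2) + u\<^sup>2 * r\<^sup>2 / 4" using uv d by (intro add_pos_nonneg) auto
  then have R0: "0 < R" by (simp add: R)
  have "v\<^sup>2 < u\<^sup>2" using uv by (simp add: power_strict_mono)
  then have "v\<^sup>2 * (d1 * d2) < u\<^sup>2 * (d1 * d2)" using d by (intro mult_strict_right_mono) auto
  also have "u\<^sup>2 * (d1 * d2) + u\<^sup>2 * r\<^sup>2 / 4 = u\<^sup>2 / 4 * (4 * (d1 * d2) + r\<^sup>2)" by (simp add: algebra_simps)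
  finally have "R\<^sup>2 < (u / 2)\<^sup>2" using Rp by (simp add: R dd power_divide)
  then have R1: "R < u / 2" using power2_less_imp_less[of R "u / 2"] uv by simp
  have "R\<^sup>2 = (v * sqrt (d1 * d2))\<^sup>2 + 0\<^sup>2 + (u * r / 2)\<^sup>2"
    using Rp d by (simp add: R power_mult_distrib power_divide)
  from mlog_bloch_artanh[OF R0 R1 this] obtain l where
    lB: "mlog B = bloch l (t * (v * sqrt (d1 * d2))) 0 (t * (u * r / 2))" unfolding B_def t by auto
  define la lb where "la = ln (p / 2 * d1)" and "lb = ln (p / 2 * d2)"
  have L: "mlog (sandwich (depolarizing p) \<rho>) = W ** blk (mlog B) la lb ** dagger W"
    unfolding S mlog_def using p d
    by (subst herm_fun_blk[OF W]) (simp_all add: B_def hermitian_bloch la_def lb_def)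
  \<comment> \<open>Off-diagonal entries after multiplying by the powers 1/2 and -1/2 on the two
    sides; they differ because this similarity is not unitary. The \<open>omega\<close> term also
    puts them on the diagonal, hence their subtraction in \<open>e1\<close> and
    \<open>e2\<close>.\<close>
  define k1 k2 e1 e2 where "k1 = t * v * d1" and "k2 = t * v * d2" and "e1 = l + t * (u * r / 2) - k1"
    and "e2 = l - t * (u * r / 2) - k2"
  define c1 c2 c3 c4 where "c1 = (e1 + e2 + la + lb) / 4" and "c2 = (e1 + e2 - la - lb) / 4"
    and "c3 = (e1 - e2 + la - lb) / 4" and "c4 = (e1 - e2 - la + lb) / 4"
  let ?Z = "diag2 1 (-1)"
  have k: "sqrt d1 * (t * (v * sqrt (d1 * d2))) * (1 / sqrt d2) = k1"
    "sqrt d2 * (t * (v * sqrt (d1 * d2))) * (1 / sqrt d1) = k2"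
    using d by (simp_all add: k1_def k2_def real_sqrt_mult)
  have M: "kron D (mat 1) ** blk (mlog B) la lb ** kron D' (mat 1) =
     c1 *\<^sub>R mat 1 + c2 *\<^sub>R kron ?Z ?Z + c3 *\<^sub>R kron ?Z (mat 1) + c4 *\<^sub>R kron (mat 1) ?Z
       + kron (diag2 k1 k2) (mat 1) ** omega"
    using blk_conj_decomposition[of "sqrt d1" "sqrt d2" l "t * (v * sqrt (d1 * d2))" "t * (u * r / 2)" la lb] d
    unfolding k lB D_def D'_def c1_def c2_def c3_def c4_def e1_def e2_def by simp
  \<comment> \<open>The second tensor factor is rotated by conj U, which turns the Bloch axis into
    its complex conjugate and so flips the sign of y.\<close>
  define N N' where "N = bloch 0 x y z" and "N' = bloch 0 x (-y) z"
  have N: "U ** ?Z ** dagger U = N" unfolding s by (simp add: N_def)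
  have "transpose (U ** ?Z ** dagger U) = Uc ** transpose ?Z ** transpose U"
    by (simp add: matrix_transpose_mul matrix_mul_assoc Uc_def)
  moreover have "transpose ?Z = ?Z" "transpose U = dagger Uc" "transpose N = N'"
    by (simp_all add: mat2_eq_iff transpose_def Uc_def N_def N'_def complex_eq_iff)
  ultimately have N': "Uc ** ?Z ** dagger Uc = N'" unfolding N by simp
  define m h where "m = (k1 + k2) / 2" and "h = (k1 - k2) / 2"
  let ?K = "bloch m (h * x) (h * y) (h * z)"
  have "W ** (kron (diag2 k1 k2) (mat 1) ** omega) ** dagger W =
      (W ** kron (diag2 k1 k2) (mat 1) ** dagger W) ** (W ** omega ** dagger W)"
    by (simp add: unitary_conj_mult[OF W])
  also have "\<dots> = kron ?K (mat 1) ** omega"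
    unfolding Wk UcI W\<omega> s m_def h_def ..
  finally have WK: "W ** (kron (diag2 k1 k2) (mat 1) ** omega) ** dagger W = kron ?K (mat 1) ** omega" .
  let ?G = "blk (bloch 1 g 0 0) 0 0"
  have "choi (dephasing q) ** pow_A \<rho> (1/2) ** mlog (sandwich (depolarizing p) \<rho>) ** pow_A \<rho> (-1/2) =
     ?G ** (W ** (kron D (mat 1) ** blk (mlog B) la lb ** kron D' (mat 1)) ** dagger W)"
  proof -
    have "pow_A \<rho> (1/2) ** mlog (sandwich (depolarizing p) \<rho>) ** pow_A \<rho> (-1/2) =
       W ** (kron D (mat 1) ** blk (mlog B) la lb ** kron D' (mat 1)) ** dagger W"
      unfolding P L sq D_def [symmetric] D'_def [symmetric] unitary_conj_mult[OF W] ..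
    from this [symmetric] show ?thesis
      by (simp only: choi_dephasing g matrix_mul_assoc)
  qed
  also have "\<dots> = ?G ** (c1 *\<^sub>R mat 1 + c2 *\<^sub>R kron N N' + c3 *\<^sub>R kron N (mat 1) + c4 *\<^sub>R kron (mat 1) N'
       + kron ?K (mat 1) ** omega)"
    unfolding M matrix_add_ldistrib matrix_add_rdistrib matrix_scalar_ac scalar_matrix_assoc [symmetric] WK Wk UcI UI N N' ..
  finally have Xeq: "X = c1 *\<^sub>R ptrace_B ?G + c2 *\<^sub>R ptrace_B (?G ** kron N N') + c3 *\<^sub>R ptrace_B (?G ** kron N (mat 1))
     + c4 *\<^sub>R ptrace_B (?G ** kron (mat 1) N') + ptrace_B (?G ** (kron ?K (mat 1) ** omega))"
    unfolding X by (simp add: matrix_add_ldistrib matrix_scalar_ac scalar_matrix_assoc [symmetric] ptrace_B_add ptrace_B_scaleR)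
  have 1: "ptrace_B ?G = bloch 1 0 0 0"
    by (simp add: ptrace_B_blk mat2_eq_iff complex_eq_iff)
  \<comment> \<open>The one term that need not be Hermitian: its off-diagonal part, proportional to
    z(x - iy), is anti-Hermitian and disappears from the Hermitian part, leaving a scalar.\<close>
  have 2: "ptrace_B (?G ** kron N N') + dagger (ptrace_B (?G ** kron N N')) = 2 *\<^sub>R bloch (z\<^sup>2 + g * (x\<^sup>2 + y\<^sup>2)) 0 0 0"
    by (simp add: mat2_eq_iff ptrace_B_def sum_2 mult_nth_22 blk_def kron_nth N_def N'_def complex_eq_iff)
      (simp add: power2_eq_square algebra_simps)
  have 3: "ptrace_B (?G ** kron N (mat 1)) = N"
    by (simp add: mat2_eq_iff ptrace_B_def sum_2 mult_nth_22 blk_def kron_nth N_def mat_def complex_eq_iff)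
  have 4: "ptrace_B (?G ** kron (mat 1) N') = bloch 0 (g * x) (g * y) z"
    by (simp add: mat2_eq_iff ptrace_B_def sum_2 mult_nth_22 blk_def kron_nth N'_def mat_def complex_eq_iff)
  have 5: "ptrace_B (?G ** (kron ?K (mat 1) ** omega)) = bloch ((1 + g) * m) 0 0 ((1 - g) * h * z)"
    by (simp add: mat2_eq_iff ptrace_B_def sum_2 mult_nth_22 blk_def kron_nth mat_def omega_def complex_eq_iff)
      (simp add: algebra_simps)
  have dq: "dagger (bloch a b c d) = bloch a b c d" for a b c d using hermitian_bloch by (simp add: hermitian_def)
  have dsc: "dagger (c *\<^sub>R A) = c *\<^sub>R dagger A" for c and A :: "2 cmat" by (simp add: vec_eq_iff)
  have "X + dagger X = c2 *\<^sub>R (ptrace_B (?G ** kron N N') + dagger (ptrace_B (?G ** kron N N')))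
     + 2 *\<^sub>R (c1 *\<^sub>R bloch 1 0 0 0 + c3 *\<^sub>R N + c4 *\<^sub>R bloch 0 (g * x) (g * y) z + bloch ((1 + g) * m) 0 0 ((1 - g) * h * z))"
    unfolding Xeq 1 3 4 5 dagger_add dsc unfolding N_def dq
    by (simp only: scaleR_add_right scaleR_2 add_ac)
  also have "\<dots> = 2 *\<^sub>R bloch (c2 * (z\<^sup>2 + g * (x\<^sup>2 + y\<^sup>2)) + c1 + (1 + g) * m) ((c3 + c4 * g) * x) ((c3 + c4 * g) * y)
      ((c3 + c4 + (1 - g) * h) * z)"
    unfolding 2 unfolding N_def bloch_scaleR bloch_add by (simp add: algebra_simps)
  also have "c3 + c4 * g = \<kappa>"
  proof -
    have "la - lb = ln d1 - ln d2" using ln_mult_pos[of "p / 2" d1] ln_mult_pos[of "p / 2" d2] p d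
      by (simp add: la_def lb_def)
    moreover have "e1 - e2 = t * r * (u - v)" by (simp add: e1_def e2_def k1_def k2_def r algebra_simps)
    moreover have "c3 + c4 * g = (e1 - e2) * (1 + g) / 4 + (la - lb) * (1 - g) / 4"
      by (simp add: c3_def c4_def field_simps)
    ultimately show ?thesis by (simp add: \<kappa>)
  qed
  also have "c3 + c4 + (1 - g) * h = \<zeta>"
    by (simp add: c3_def c4_def \<zeta> h_def e1_def e2_def k1_def k2_def r field_simps)
  finally show ?thesis by blast
qed

section \<open>The operator Omega and its fixed points\<close>

text \<open>The derivative 1 / (1 - t^2) is at most its value at x on [0, x] and at least that value
  on [x, y]; the mean value theorem on both intervals gives y artanh x \<le> x artanh y.\<close>

lemma artanh_over_id_mono:
  fixes x y :: real
  assumes "0 < x" "x \<le> y" "y < 1"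
  shows "artanh x / x \<le> artanh y / y"
proof -
  have der: "(artanh has_real_derivative 1 / (1 - t\<^sup>2)) (at t)" if "0 \<le> t" "t < 1" for t :: real
    using that by (intro artanh_real_has_field_derivative[THEN DERIV_cong]) auto
  have "\<exists>\<xi>. 0 < \<xi> \<and> \<xi> < x \<and> artanh x - artanh 0 = (x - 0) * (1 / (1 - \<xi>\<^sup>2))"
    using assms by (intro MVT2 der) auto
  then obtain \<xi> where \<xi>: "0 < \<xi>" "\<xi> < x" "artanh x = x * (1 / (1 - \<xi>\<^sup>2))" by auto
  have x2: "x\<^sup>2 < 1" using assms by (simp add: power_less_one_iff)
  have "\<xi>\<^sup>2 \<le> x\<^sup>2" using \<xi> by (intro power_mono) auto
  then have 1: "artanh x \<le> x * (1 / (1 - x\<^sup>2))" unfolding \<xi>(3)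
    using assms x2 by (intro mult_left_mono divide_left_mono) auto
  show ?thesis
  proof (cases "x = y")
    case False
    have "\<exists>\<eta>. x < \<eta> \<and> \<eta> < y \<and> artanh y - artanh x = (y - x) * (1 / (1 - \<eta>\<^sup>2))"
      using assms False by (intro MVT2 der) auto
    then obtain \<eta> where \<eta>: "x < \<eta>" "\<eta> < y" "artanh y - artanh x = (y - x) * (1 / (1 - \<eta>\<^sup>2))" by auto
    have "x\<^sup>2 \<le> \<eta>\<^sup>2" "\<eta>\<^sup>2 < 1" using \<eta> assms by (auto intro: power_mono simp: power_less_one_iff)
    then have "(y - x) * (1 / (1 - x\<^sup>2)) \<le> artanh y - artanh x" unfolding \<eta>(3)
      using assms x2 by (intro mult_left_mono divide_left_mono) auto
    then have 2: "x * ((y - x) * (1 / (1 - x\<^sup>2))) \<le> x * (artanh y - artanh x)"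
      using assms by (intro mult_left_mono) auto
    have "(y - x) * artanh x \<le> (y - x) * (x * (1 / (1 - x\<^sup>2)))"
      using assms 1 by (intro mult_left_mono) auto
    with 2 have "y * artanh x \<le> x * artanh y" by (simp add: algebra_simps)
    then show ?thesis using assms by (simp add: field_simps)
  qed simp
qed

lemma artanh_real_pos: "0 < artanh x" if "0 < x" "x < 1" for x :: real
  using that by (simp add: artanh_def)

section \<open>Omega of a qubit state and the signs of its coefficients\<close>

lemma qubit_state_spectral:
  fixes \<rho> :: "2 cmat"
  assumes "density_operator \<rho>" "pos_def \<rho>"
  obtains U s x y z where "\<rho> = bloch (1/2) (s * x) (s * y) (s * z)" "0 \<le> s" "s < 1/2" "x\<^sup>2 + y\<^sup>2 + z\<^sup>2 = 1"
    "unitary U" "\<rho> = U ** diag2 (1/2 + s) (1/2 - s) ** dagger U"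
    "\<And>a b. U ** diag2 a b ** dagger U = bloch ((a + b) / 2) ((a - b) / 2 * x) ((a - b) / 2 * y) ((a - b) / 2 * z)"
proof -
  obtain s x y z where 1: "\<rho> = bloch (1/2) (s * x) (s * y) (s * z)" "x\<^sup>2 + y\<^sup>2 + z\<^sup>2 = 1" "0 \<le> s" "s < 1/2"
    using density_operator_bloch_obtain[OF assms(1)] assms(2) by metis
  obtain U :: "2 cmat" where U: "unitary U" and
    U': "\<And>d. U ** real_diag d ** dagger U =
       bloch ((d 1 + d 2) / 2) ((d 1 - d 2) / 2 * x) ((d 1 - d 2) / 2 * y) ((d 1 - d 2) / 2 * z)"
    using qubit_spectral[OF 1(2)] by metis
  have U'': "U ** diag2 a b ** dagger U = bloch ((a + b) / 2) ((a - b) / 2 * x) ((a - b) / 2 * y) ((a - b) / 2 * z)" for a b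
    unfolding diag2_def U' by simp
  then have "\<rho> = U ** diag2 (1/2 + s) (1/2 - s) ** dagger U" using 1(1) by simp
  then show ?thesis using that 1 U U'' by blast
qed

lemma mpow_qubit_state:
  fixes \<rho> :: "2 cmat"
  assumes "density_operator \<rho>" "pos_def \<rho>"
  shows "mpow \<rho> s ** mpow \<rho> t = mpow \<rho> (s + t)" "mpow \<rho> 0 = mat 1" "mpow \<rho> 1 = \<rho>" "dagger (mpow \<rho> s) = mpow \<rho> s"
proof -
  obtain U c x y z where \<rho>: "0 \<le> c" "c < 1/2" "unitary U" "\<rho> = U ** diag2 (1/2 + c) (1/2 - c) ** dagger U"
    using qubit_state_spectral[OF assms] by metis
  note * = mpow_unitary_diag_mult[OF \<rho>(3) _ \<rho>(4)[unfolded diag2_def]]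
  show "mpow \<rho> s ** mpow \<rho> t = mpow \<rho> (s + t)" "mpow \<rho> 0 = mat 1" "mpow \<rho> 1 = \<rho>" "dagger (mpow \<rho> s) = mpow \<rho> s"
    using \<rho>(1,2) by (auto intro!: *)
qed

text \<open>The x and y coefficients come from the depolarizing logarithm alone; the dephasing one
  enters, with a minus sign, only in the coefficient \<zeta> and the scalar part.\<close>

lemma Omega_qubit:
  fixes \<rho> :: "2 cmat"
  assumes "density_operator \<rho>" "pos_def \<rho>" and s: "0 \<le> s" "s < 1/2" and n: "x\<^sup>2 + y\<^sup>2 + z\<^sup>2 = 1"
    and U: "unitary U" and \<rho>: "\<rho> = U ** diag2 (1/2 + s) (1/2 - s) ** dagger U"
    and U': "\<And>a b. U ** diag2 a b ** dagger U = bloch ((a + b) / 2) ((a - b) / 2 * x) ((a - b) / 2 * y) ((a - b) / 2 * z)"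
    and p: "0 < p" "p < 1" and q: "0 < q" "q < 1" "q \<noteq> 1/2"
    and g: "g = 2 * q - 1" and u: "u = 1 - p / 2" and v: "v = 1 - p"
    and R1: "R1 = sqrt (g\<^sup>2 * (1/4 - (s * z)\<^sup>2) + (s * z)\<^sup>2)" and t1: "t1 = artanh (2 * R1) / R1"
    and R2: "R2 = sqrt (v\<^sup>2 * (1/4 - s\<^sup>2) + u\<^sup>2 * s\<^sup>2)" and t2: "t2 = artanh (R2 / (u / 2)) / R2"
    and \<kappa>: "\<kappa> = t2 * s * (u - v) * (1 + g) / 2 + (ln (1/2 + s) - ln (1/2 - s)) * (1 - g) / 4"
    and \<zeta>: "\<zeta> = s * (t2 * (u - g * v) - t1 * (1 - g\<^sup>2))"
  shows "\<exists>\<alpha>. Omega (dephasing q) (depolarizing p) \<rho> = bloch \<alpha> (\<kappa> * x) (\<kappa> * y) (\<zeta> * z)"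
proof -
  note m = mpow_qubit_state[OF assms(1,2)]
  have \<rho>': "\<rho> = bloch (1/2) (s * x) (s * y) (s * z)" unfolding \<rho> U' by simp
  define a b where "a = 1 / (1/2 + s)" and "b = 1 / (1/2 - s)"
  have ab: "0 < a" "0 < b" using s by (auto simp: a_def b_def)
  have "mpow \<rho> (-1) = U ** diag2 a b ** dagger U"
    unfolding \<rho> mpow_unitary_diag2[OF U] using s by (simp add: powr_minus_divide a_def b_def)
  then have inv: "mpow \<rho> (-1/2) ** mpow \<rho> (-1/2) = bloch ((a + b) / 2) ((a - b) / 2 * x) ((a - b) / 2 * y) ((a - b) / 2 * z)"
    unfolding m U' by simp
  have "z\<^sup>2 \<le> 1" using n by (smt (verit) zero_le_power2)
  then have z: "\<bar>z\<bar> \<le> 1" by (simp add: abs_square_le_1)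
  have pos: "0 < (a + b) / 2 + (a - b) / 2 * z" "0 < (a + b) / 2 - (a - b) / 2 * z"
  proof -
    have "\<bar>(a - b) * z\<bar> \<le> \<bar>a - b\<bar>" using mult_left_mono[OF z, of "\<bar>a - b\<bar>"] by (simp add: abs_mult)
    also have "\<bar>a - b\<bar> < a + b" using ab by linarith
    finally show "0 < (a + b) / 2 + (a - b) / 2 * z" "0 < (a + b) / 2 - (a - b) / 2 * z" by (auto simp: abs_less_iff field_simps)
  qed
  have "s * \<bar>z\<bar> \<le> s * 1" using s z by (intro mult_left_mono) auto
  then have w: "\<bar>s * z\<bar> < 1/2" using s by (simp add: abs_mult)
  let ?X1 = "ptrace_B (choi (dephasing q) ** pow_A \<rho> (1/2) ** mlog (sandwich (dephasing q) \<rho>) ** pow_A \<rho> (-1/2))"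
  let ?X2 = "ptrace_B (choi (dephasing q) ** pow_A \<rho> (1/2) ** mlog (sandwich (depolarizing p) \<rho>) ** pow_A \<rho> (-1/2))"
  have "\<exists>l. ?X1 = bloch l 0 0 (artanh (2 * R1) / R1 * (s * z) * (1 - g\<^sup>2))"
    by (rule ptrace_log_dephasing[OF _ _ _ inv _ _ pos \<rho>' w q g R1]) (simp_all add: m)
  then obtain l where X1: "?X1 = bloch l 0 0 (t1 * (s * z) * (1 - g\<^sup>2))" unfolding t1 by blast
  have "\<exists>\<alpha>. ?X2 + dagger ?X2 = 2 *\<^sub>R bloch \<alpha> (\<kappa> * x) (\<kappa> * y) ((s * t2 * (u - g * v)) * z)"
  proof (rule ptrace_log_depolarizing[OF U U' _ _ _ \<rho> p g u v refl _ t2 refl])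
    show "R2 = sqrt (v\<^sup>2 * ((1 / 2 + s) * (1 / 2 - s)) + u\<^sup>2 * (1 / 2 + s - (1 / 2 - s))\<^sup>2 / 4)"
      unfolding R2 by (simp add: power2_eq_square algebra_simps)
  qed (use s in \<open>simp_all add: \<kappa> field_simps\<close>)
  then obtain \<alpha> where X2: "?X2 + dagger ?X2 = 2 *\<^sub>R bloch \<alpha> (\<kappa> * x) (\<kappa> * y) ((s * t2 * (u - g * v)) * z)" by blast
  have O: "Omega1 (dephasing q) (depolarizing p) \<rho> = ?X2 - ?X1"
    unfolding Omega1_def by (simp add: matrix_diff_ldistrib matrix_diff_rdistrib ptrace_B_diff)
  have "dagger ?X1 = ?X1" using hermitian_bloch unfolding X1 hermitian_def by blast
  then have "Omega (dephasing q) (depolarizing p) \<rho> = (1/2) *\<^sub>R ((?X2 + dagger ?X2) - (?X1 + ?X1))"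
    unfolding Omega_def O dagger_diff by (simp add: algebra_simps)
  also have "\<dots> = bloch (\<alpha> - l) (\<kappa> * x) (\<kappa> * y) (\<zeta> * z)"
    unfolding X2 unfolding X1 bloch_scaleR bloch_add bloch_diff by (simp add: \<zeta> algebra_simps)
  finally show ?thesis by blast
qed

lemma Omega_qubit_signs:
  fixes \<rho> :: "2 cmat"
  assumes \<rho>: "density_operator \<rho>" "pos_def \<rho>" "\<rho> = bloch (1/2) a b c" and p: "p = 0.05" and q: "q = 0.4"
  shows "\<exists>\<alpha> k l. 0 < k \<and> 0 < l \<and> Omega (dephasing q) (depolarizing p) \<rho> = bloch \<alpha> (k * a) (k * b) (l * c)"
proof -
  obtain U s x y z where 1: "\<rho> = bloch (1/2) (s * x) (s * y) (s * z)" and s: "0 \<le> s" "s < 1/2" and n: "x\<^sup>2 + y\<^sup>2 + z\<^sup>2 = 1"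
    and U: "unitary U" "\<rho> = U ** diag2 (1/2 + s) (1/2 - s) ** dagger U"
    "\<And>a b. U ** diag2 a b ** dagger U = bloch ((a + b) / 2) ((a - b) / 2 * x) ((a - b) / 2 * y) ((a - b) / 2 * z)"
    using qubit_state_spectral[OF \<rho>(1,2)] by metis
  have abc: "a = s * x" "b = s * y" "c = s * z" using 1 \<rho>(3) by auto
  define g u v :: real where "g = -1/5" and "u = 39/40" and "v = 19/20"
  have g: "g = 2 * q - 1" and u: "u = 1 - p / 2" and v: "v = 1 - p" by (simp_all add: g_def u_def v_def p q)
  define R1 where "R1 = sqrt (g\<^sup>2 * (1/4 - (s * z)\<^sup>2) + (s * z)\<^sup>2)"
  define t1 where "t1 = artanh (2 * R1) / R1"
  define R2 where "R2 = sqrt (v\<^sup>2 * (1/4 - s\<^sup>2) + u\<^sup>2 * s\<^sup>2)"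
  define t2 where "t2 = artanh (R2 / (u / 2)) / R2"
  define \<kappa> where "\<kappa> = t2 * s * (u - v) * (1 + g) / 2 + (ln (1/2 + s) - ln (1/2 - s)) * (1 - g) / 4"
  define \<zeta> where "\<zeta> = s * (t2 * (u - g * v) - t1 * (1 - g\<^sup>2))"
  obtain \<alpha> where O: "Omega (dephasing q) (depolarizing p) \<rho> = bloch \<alpha> (\<kappa> * x) (\<kappa> * y) (\<zeta> * z)"
    using Omega_qubit[OF \<rho>(1,2) s n U _ _ _ _ _ g u v R1_def t1_def R2_def t2_def \<kappa>_def \<zeta>_def] by (auto simp: p q)
  have "z\<^sup>2 \<le> 1" using n by (smt (verit) zero_le_power2)
  then have sz: "(s * z)\<^sup>2 \<le> s\<^sup>2" using mult_left_mono[of "z\<^sup>2" 1 "s\<^sup>2"] by (simp add: power_mult_distrib)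
  have s2: "s\<^sup>2 < 1/4" using s power_strict_mono[of s "1/2" 2] by (simp add: power2_eq_square)
  have R1p: "0 < R1" unfolding R1_def using sz s2
    by (intro iffD2[OF real_sqrt_gt_0_iff] add_pos_nonneg mult_pos_pos) (auto simp: g_def)
  have R2p: "0 < R2" unfolding R2_def using s2
    by (intro iffD2[OF real_sqrt_gt_0_iff] add_pos_nonneg mult_pos_pos) (auto simp: v_def)
  have squares: "g\<^sup>2 = 1/25" "u\<^sup>2 = 1521/1600" "v\<^sup>2 = 361/400"
    by (simp_all add: g_def u_def v_def power_divide)
  \<comment> \<open>Comparison of the two artanh arguments. Squared, it is linear in (s z)^2 and
    s^2; the extreme case of equal squares follows from u^2 / 25 < v^2.\<close>
  have le: "2 * R1 \<le> R2 / (u / 2)"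
  proof -
    have *: "1521/1600 * (1/25 * (1/4 - X) + X) \<le> 361/400 * (1/4 - Y) + 1521/1600 * Y"
      if "X \<le> Y" "Y < 1/4" for X Y :: real using that by argo
    have "u * R1 \<le> R2"
    proof (rule power2_le_imp_le)
      have "(u * R1)\<^sup>2 = u\<^sup>2 * (g\<^sup>2 * (1/4 - (s * z)\<^sup>2) + (s * z)\<^sup>2)"
        unfolding power_mult_distrib[of u] using R1p by (simp add: R1_def)
      also have "\<dots> \<le> v\<^sup>2 * (1/4 - s\<^sup>2) + u\<^sup>2 * s\<^sup>2"
        using * sz s2 unfolding squares by blast
      also have "\<dots> = R2\<^sup>2" using R2p by (simp add: R2_def)
      finally show "(u * R1)\<^sup>2 \<le> R2\<^sup>2" .
    qed (use R2p in simp)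
    then show ?thesis by (simp add: u_def)
  qed
  have lt: "R2 / (u / 2) < 1"
  proof -
    have "R2 < u / 2"
    proof (rule power2_less_imp_less)
      have "R2\<^sup>2 = v\<^sup>2 * (1/4 - s\<^sup>2) + u\<^sup>2 * s\<^sup>2" using R2p by (simp add: R2_def)
      also have "\<dots> < (u / 2)\<^sup>2"
      proof -
        have "361/400 * (1/4 - Y) + 1521/1600 * Y < 1521/6400" if "Y < 1/4" for Y :: real
          using that by argo
        moreover have "(u / 2)\<^sup>2 = 1521/6400" by (simp add: u_def power_divide)
        ultimately show ?thesis using s2 unfolding squares by presburger
      qed
      finally show "R2\<^sup>2 < (u / 2)\<^sup>2" .
    qed (simp add: u_def)
    then show ?thesis by (simp add: u_def)
  qed
  have t1: "0 < t1" unfolding t1_def using R1p le lt by (intro divide_pos_pos artanh_real_pos) auto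
  \<comment> \<open>Both sides have the form artanh w / w, with w = 2 R1 on the left and w = R2 / (u
    / 2) on the right.\<close>
  have "t1 / 2 \<le> t2 * (u / 2)"
    using artanh_over_id_mono[OF _ le lt] R1p by (simp add: t1_def t2_def)
  then have t12: "t1 \<le> 39/40 * t2" by (simp add: u_def)
  then have t2: "0 < t2" using t1 by linarith
  \<comment> \<open>Numerically u - g v = 1.165 while (1 - g^2) * 39/40 = 0.936; the negative g
    increases the first quantity.\<close>
  have l: "0 < t2 * (u - g * v) - t1 * (1 - g\<^sup>2)" using t12 t1 by (simp add: u_def g_def v_def power_divide)
  show ?thesis
  proof (cases "s = 0")
    case True
    \<comment> \<open>At the maximally mixed state a = b = c = 0, so any positive coefficients serve
      and no division by s is needed.\<close>
    then show ?thesis using O by (intro exI[of _ \<alpha>] exI[of _ 1]) (simp add: abc \<kappa>_def \<zeta>_def)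
  next
    case False
    then have s0: "0 < s" using s by simp
    have "ln (1/2 - s) < ln (1/2 + s)" using s s0 by simp
    moreover have "0 < t2 * s * (u - v) * (1 + g) / 2" using s0 t2 by (simp add: u_def v_def g_def)
    ultimately have k: "0 < \<kappa> / s" unfolding \<kappa>_def using s0
      by (intro divide_pos_pos add_pos_nonneg) (auto simp: g_def)
    have "Omega (dephasing q) (depolarizing p) \<rho> =
        bloch \<alpha> (\<kappa> / s * a) (\<kappa> / s * b) ((t2 * (u - g * v) - t1 * (1 - g\<^sup>2)) * c)"
      unfolding O abc using s0 by (simp add: \<zeta>_def)
    then show ?thesis using k l by blast
  qed
qed

text \<open>Taking logarithms in \<rho> = gibbs (G + l H) cancels \<open>mlog \<rho>\<close> and
  leaves Omega as \<gamma> times a combination of H and the identity. Conversely, the multiplier l /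
  \<gamma> cancels Omega up to a scalar, which \<open>gibbs\<close> ignores.\<close>

lemma T_AB_fixed_point_iff:
  fixes \<rho> :: "2 cmat"
  assumes \<rho>: "\<rho> \<in> constraint_set (bloch 0 h1 h2 h3) E" "pos_def \<rho>" and "0 < \<gamma>"
    and h: "h1\<^sup>2 + h2\<^sup>2 + h3\<^sup>2 = 1" and E: "-1 < E" "E < 1"
    and O: "hermitian (Omega N1 N2 \<rho>)"
  shows "T_AB N1 N2 \<gamma> (constraint_set (bloch 0 h1 h2 h3) E) \<rho> = \<rho> \<longleftrightarrow>
    (\<exists>c l. Omega N1 N2 \<rho> = bloch c (l * h1) (l * h2) (l * h3))"
proof -
  let ?H = "bloch 0 h1 h2 h3" and ?O = "Omega N1 N2 \<rho>"
  let ?M = "constraint_set ?H E"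
  have d: "density_operator \<rho>" using \<rho> by (simp add: constraint_set_def)
  obtain o0 o1 o2 o3 where O': "?O = bloch o0 o1 o2 o3" using O by (rule hermitian_2_obtain)
  obtain m0 m1 m2 m3 where m: "mlog \<rho> = bloch m0 m1 m2 m3" using gibbs_mlog(1)[OF d \<rho>(2)] by (rule hermitian_2_obtain)
  define G where "G = mlog \<rho> - (1/\<gamma>) *\<^sub>R ?O"
  have G: "hermitian G" unfolding G_def O' m bloch_scaleR bloch_diff by (rule hermitian_bloch)
  have T: "T_AB N1 N2 \<gamma> ?M \<rho> = gibbs (G + l *\<^sub>R ?H)" if "gibbs (G + l *\<^sub>R ?H) \<in> ?M" for l
    unfolding T_AB_def F3_eq_gibbs G_def [symmetric] by (rule arg_min_gibbs[OF G hermitian_bloch that])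
  show ?thesis
  proof
    assume fixp: "T_AB N1 N2 \<gamma> ?M \<rho> = \<rho>"
    obtain l where "gibbs (G + l *\<^sub>R ?H) \<in> ?M" using exists_gibbs_in_constraint_set[OF G h E] .
    then have \<rho>eq: "\<rho> = gibbs (G + l *\<^sub>R ?H)" using T fixp by simp
    have "hermitian (G + l *\<^sub>R ?H)" unfolding G_def O' m bloch_scaleR bloch_diff bloch_add by (rule hermitian_bloch)
    then obtain c where "mlog \<rho> = G + l *\<^sub>R ?H - bloch c 0 0 0" using gibbs_2(3) \<rho>eq by metis
    then have "?O = bloch (- \<gamma> * c) (\<gamma> * l * h1) (\<gamma> * l * h2) (\<gamma> * l * h3)"
      using \<open>0 < \<gamma>\<close> unfolding G_def m O' bloch_scaleR bloch_diff bloch_add bloch_eq_iff by (auto simp: field_simps)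
    then show "\<exists>c l. ?O = bloch c (l * h1) (l * h2) (l * h3)" by blast
  next
    assume "\<exists>c l. ?O = bloch c (l * h1) (l * h2) (l * h3)"
    then obtain c l where "?O = bloch c (l * h1) (l * h2) (l * h3)" by blast
    then have "G + (l / \<gamma>) *\<^sub>R ?H = mlog \<rho> + bloch (- c / \<gamma>) 0 0 0"
      unfolding G_def m by (simp add: bloch_scaleR bloch_diff bloch_add)
    then have "gibbs (G + (l / \<gamma>) *\<^sub>R ?H) = \<rho>" using gibbs_mlog(2)[OF d \<rho>(2)] by simp
    then show "T_AB N1 N2 \<gamma> ?M \<rho> = \<rho>" using T \<rho>(1) by metis
  qed
qed

theorem theorem20:
  fixes p q \<gamma> E :: real and H \<rho>hat :: "2 cmat"
    and N1 N2 :: "2 cmat \<Rightarrow> 2 cmat" and M :: "2 cmat set"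
  assumes "p = 0.05" and "q = 0.4" and "\<gamma> > 0"
    and "N1 = dephasing q" and "N2 = depolarizing p"
    and "H \<in> {sigma_x, sigma_y, sigma_z}" and "E \<in> {-1<..<1}"
    and "M = constraint_set H E"
    and "\<rho>hat = (1/2) *\<^sub>R (mat 1 + E *\<^sub>R H)"
  shows "(\<forall>\<rho>\<in>M. pos_def \<rho> \<longrightarrow>
            complex_of_real (objective N1 N2 \<rho>) = trace (\<rho> ** Omega N1 N2 \<rho>)) \<and>
         \<rho>hat \<in> M \<and> pos_def \<rho>hat \<and> T_AB N1 N2 \<gamma> M \<rho>hat = \<rho>hat \<and>
         (\<forall>\<rho>\<in>M. pos_def \<rho> \<and> T_AB N1 N2 \<gamma> M \<rho> = \<rho> \<longrightarrow> \<rho> = \<rho>hat)"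
proof -
  obtain h1 h2 h3 where H: "H = bloch 0 h1 h2 h3"
    and axis: "(h1, h2, h3) \<in> {(1, 0, 0), (0, 1, 0), (0, 0, 1)}"
    using assms(6) unfolding sigma_bloch by fastforce
  have h: "h1\<^sup>2 + h2\<^sup>2 + h3\<^sup>2 = 1" using axis by auto
  have E: "-1 < E" "E < 1" using assms(7) by auto
  have hat: "\<rho>hat = bloch (1/2) (E / 2 * h1) (E / 2 * h2) (E / 2 * h3)"
    unfolding assms(9) H mat_1_bloch by (simp add: bloch_scaleR bloch_add)
  have "(E / 2 * h1)\<^sup>2 + (E / 2 * h2)\<^sup>2 + (E / 2 * h3)\<^sup>2 = (E / 2)\<^sup>2 * (h1\<^sup>2 + h2\<^sup>2 + h3\<^sup>2)"
    unfolding power_mult_distrib by (simp add: algebra_simps)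
  also have "\<dots> < (1/2)\<^sup>2" using E h by (simp add: power_divide abs_square_less_1 abs_less_iff)
  finally have pd: "pos_def \<rho>hat" unfolding hat by (intro pos_def_blochI) auto
  then have "density_operator \<rho>hat"
    using pos_def_imp_pos_semidef unfolding density_operator_def hat trace_eq_1_bloch by auto
  moreover have "trace (\<rho>hat ** H) = complex_of_real E"
    unfolding hat H trace_bloch_mult using axis by auto
  ultimately have hatM: "\<rho>hat \<in> M" unfolding assms(8) constraint_set_def by simp
  have iff: "T_AB N1 N2 \<gamma> M \<rho> = \<rho> \<longleftrightarrow> (\<exists>\<alpha> l. Omega N1 N2 \<rho> = bloch \<alpha> (l * h1) (l * h2) (l * h3))"
    and sgn: "\<rho> = bloch (1/2) a b c \<Longrightarrow>
        \<exists>\<alpha> k l. 0 < k \<and> 0 < l \<and> Omega N1 N2 \<rho> = bloch \<alpha> (k * a) (k * b) (l * c)"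
    if \<rho>: "\<rho> \<in> M" "pos_def \<rho>" for \<rho> a b c
  proof -
    have d: "density_operator \<rho>" using \<rho> by (simp add: assms(8) constraint_set_def)
    show sgn: "\<exists>\<alpha> k l. 0 < k \<and> 0 < l \<and> Omega N1 N2 \<rho> = bloch \<alpha> (k * a) (k * b) (l * c)"
      if "\<rho> = bloch (1/2) a b c" for a b c
      unfolding assms(4,5) by (rule Omega_qubit_signs[OF d \<rho>(2) that assms(1,2)])
    obtain a b c where "\<rho> = bloch (1/2) a b c" using density_operator_bloch_obtain[OF d] by metis
    then have O: "hermitian (Omega N1 N2 \<rho>)" using sgn hermitian_bloch by metis
    show "T_AB N1 N2 \<gamma> M \<rho> = \<rho> \<longleftrightarrow> (\<exists>\<alpha> l. Omega N1 N2 \<rho> = bloch \<alpha> (l * h1) (l * h2) (l * h3))"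
      using \<rho> unfolding assms(8) H by (intro T_AB_fixed_point_iff assms(3) h E O)
  qed
  have "complex_of_real (objective N1 N2 \<rho>) = trace (\<rho> ** Omega N1 N2 \<rho>)"
    if \<rho>: "\<rho> \<in> M" "pos_def \<rho>" for \<rho>
  proof -
    have d: "density_operator \<rho>" using \<rho> by (simp add: assms(8) constraint_set_def)
    note m = mpow_qubit_state[OF d \<rho>(2)]
    show ?thesis
    proof (rule objective_eq_trace)
      show "hermitian \<rho>" using \<rho>(2) by (simp add: pos_def_def)
      show "mpow \<rho> (-1/2) ** \<rho> = mpow \<rho> (1/2)" using m(1)[of "-1/2" 1] unfolding m(3) by simp
    qed
  qed
  moreover have "T_AB N1 N2 \<gamma> M \<rho>hat = \<rho>hat"
  proof -
    obtain \<alpha> k l where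
      O: "Omega N1 N2 \<rho>hat = bloch \<alpha> (k * (E / 2 * h1)) (k * (E / 2 * h2)) (l * (E / 2 * h3))"
      using sgn[OF hatM pd hat] by blast
    show ?thesis unfolding iff[OF hatM pd]
      \<comment> \<open>The multiplier is the Omega coefficient belonging to the axis of H:
        \<open>l\<close> for sigma_z, \<open>k\<close> for the other two.\<close>
      by (rule exI[of _ \<alpha>], rule exI[of _ "if h3 = 0 then k * (E / 2) else l * (E / 2)"])
        (use axis in \<open>auto simp: O\<close>)
  qed
  moreover have "\<rho> = \<rho>hat" if \<rho>: "\<rho> \<in> M" "pos_def \<rho>" "T_AB N1 N2 \<gamma> M \<rho> = \<rho>" for \<rho>
  proof -
    have d: "density_operator \<rho>" and tr: "trace (\<rho> ** H) = complex_of_real E"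
      using \<rho> by (simp_all add: assms(8) constraint_set_def)
    obtain a b c where abc: "\<rho> = bloch (1/2) a b c" using density_operator_bloch_obtain[OF d] by metis
    obtain \<alpha> k l where kl: "0 < k" "0 < l" and O: "Omega N1 N2 \<rho> = bloch \<alpha> (k * a) (k * b) (l * c)"
      using sgn[OF \<rho>(1,2) abc] by blast
    obtain \<beta> m where O': "Omega N1 N2 \<rho> = bloch \<beta> (m * h1) (m * h2) (m * h3)"
      using iff[OF \<rho>(1,2)] \<rho>(3) by blast
    \<comment> \<open>Positivity of \<open>k\<close> and \<open>l\<close> makes the components off
      the axis of H vanish; the trace constraint then fixes the remaining one as E / 2.\<close>
    have eqs: "k * a = m * h1" "k * b = m * h2" "l * c = m * h3" using O O' by simp_all
    have "2 * (1/2 * 0 + a * h1 + b * h2 + c * h3) = E"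
      using tr unfolding abc H trace_bloch_mult of_real_eq_iff .
    then show ?thesis using axis eqs kl unfolding abc hat by auto
  qed
  ultimately show ?thesis using hatM pd by blast
qed

end
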